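(* There is an algorithm which, given two connected graphs $G$, $G'$ of order $n$ on the same vertex set $V$, each having at least one vertex of even degree, and a set $L$ of $\ell$ linear constraints over $\mathbb{F}_2$ on quadruples $(A,B,C,D)$ of subsets of $V$, computes a quadruple $(A,B,C,D)$ of subsets of $V$ satisfying all constraints of $L$ together with (i) for all $u,v\in V$, $|B\cap N_G(u)\cap N_{G'}(v)|+|A\cap N_G(u)\cap\{v\}|+|D\cap\{u\}\cap N_{G'}(v)|+|C\cap\{u\}\cap\{v\}|=0\bmod 2$, and (ii) $(A\cap D)\,\Delta\,(B\cap C)=V$, whenever such a quadruple exists, and otherwise reports that there is no solution, in runtime $O((n^2+\ell)n^2)$.
   Context: All graphs are finite, simple and undirected. $N_G(u)$ is the neighbourhood of $u$ in $G$, and $\Delta$ is the symmetric difference of sets. A subset of $V$ is identified with its indicator vector in $\mathbb{F}_2^V$, so that quadruples of subsets of $V$ form the $\mathbb{F}_2$-vector space $(\mathbb{F}_2^V)^4$ (addition is componentwise symmetric difference). A linear constraint is a homogeneous linear equation over $\mathbb{F}_2$ in the $4n$ coordinates of $(A,B,C,D)$. (For reference: by a theorem of Bouchet, $G$ and $G'$ are related by a sequence of local complementations if and only if (i) and (ii) have a common solution.) *)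

theory Defs
  imports "Graph_Theory.Graph_Theory" "HOL-Library.Z2" "HOL-Library.Indicator_Function"
begin

section \<open>Graphs, linear constraints and the two conditions\<close>

text \<open>
  Finite simple undirected graphs are the \<^locale>\<open>pair_graph\<close>s of the library: finite, loopless,
  with a symmetric arc relation.
\<close>

definition nbhd :: "'a pair_pre_digraph \<Rightarrow> 'a \<Rightarrow> 'a set" where
  "nbhd G u = {v. (u, v) \<in> parcs G}"

type_synonym 'a quadruple = "'a set \<times> 'a set \<times> 'a set \<times> 'a set"

text \<open>
  The coefficients of a homogeneous linear equation, one function per component of the quadruple.
  Values outside the vertex set play no role.
\<close>

type_synonym 'a constraint = "('a \<Rightarrow> bit) \<times> ('a \<Rightarrow> bit) \<times> ('a \<Rightarrow> bit) \<times> ('a \<Rightarrow> bit)"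

fun satisfies :: "'a set \<Rightarrow> 'a quadruple \<Rightarrow> 'a constraint \<Rightarrow> bool" where
  "satisfies V (A, B, C, D) (a, b, c, d) \<longleftrightarrow>
     (\<Sum>v\<in>V. a v * indicator A v + b v * indicator B v + c v * indicator C v + d v * indicator D v)
       = (0 :: bit)"

fun cond_i :: "'a set \<Rightarrow> 'a pair_pre_digraph \<Rightarrow> 'a pair_pre_digraph \<Rightarrow> 'a quadruple \<Rightarrow> bool" where
  "cond_i V G G' (A, B, C, D) \<longleftrightarrow>
     (\<forall>u\<in>V. \<forall>v\<in>V.
        (card (B \<inter> nbhd G u \<inter> nbhd G' v) + card (A \<inter> nbhd G u \<inter> {v})
         + card (D \<inter> {u} \<inter> nbhd G' v) + card (C \<inter> {u} \<inter> {v})) mod 2 = 0)"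

fun cond_ii :: "'a set \<Rightarrow> 'a quadruple \<Rightarrow> bool" where
  "cond_ii V (A, B, C, D) \<longleftrightarrow> sym_diff (A \<inter> D) (B \<inter> C) = V"

fun subsets_of :: "'a set \<Rightarrow> 'a quadruple \<Rightarrow> bool" where
  "subsets_of V (A, B, C, D) \<longleftrightarrow> A \<subseteq> V \<and> B \<subseteq> V \<and> C \<subseteq> V \<and> D \<subseteq> V"

definition is_solution ::
  "'a set \<Rightarrow> 'a pair_pre_digraph \<Rightarrow> 'a pair_pre_digraph \<Rightarrow> 'a constraint list \<Rightarrow> 'a quadruple \<Rightarrow> bool"
where
  "is_solution V G G' L Q \<longleftrightarrow>
     subsets_of V Q \<and> (\<forall>l\<in>set L. satisfies V Q l) \<and> cond_i V G G' Q \<and> cond_ii V Q"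

section \<open>Model of computation: structured programs on a word RAM\<close>

text \<open>
  A state consists of registers and a memory addressed by natural numbers. Subtraction is
  truncated. Every operation costs one unit of time; in exchange, execution under the word bound
  \<open>W\<close> gets stuck as soon as some evaluated number (literals, addresses and intermediate results
  included) is not below \<open>W\<close>.
\<close>

record ram =
  reg :: "string \<Rightarrow> nat"
  mem :: "nat \<Rightarrow> nat"

datatype expr =
    Const nat
  | Reg string
  | Load expr
  | Add expr expr
  | Sub expr expr
  | Mul expr expr

primrec val :: "ram \<Rightarrow> expr \<Rightarrow> nat" where
  "val s (Const k) = k"
| "val s (Reg x) = reg s x"
| "val s (Load e) = mem s (val s e)"
| "val s (Add e f) = val s e + val s f"
| "val s (Sub e f) = val s e - val s f"
| "val s (Mul e f) = val s e * val s f"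

primrec subexprs :: "expr \<Rightarrow> expr set" where
  "subexprs (Const k) = {Const k}"
| "subexprs (Reg x) = {Reg x}"
| "subexprs (Load e) = insert (Load e) (subexprs e)"
| "subexprs (Add e f) = insert (Add e f) (subexprs e \<union> subexprs f)"
| "subexprs (Sub e f) = insert (Sub e f) (subexprs e \<union> subexprs f)"
| "subexprs (Mul e f) = insert (Mul e f) (subexprs e \<union> subexprs f)"

definition fits :: "nat \<Rightarrow> ram \<Rightarrow> expr \<Rightarrow> bool" where
  "fits W s e \<longleftrightarrow> (\<forall>f\<in>subexprs e. val s f < W)"

primrec cost :: "expr \<Rightarrow> nat" where
  "cost (Const k) = 1"
| "cost (Reg x) = 1"
| "cost (Load e) = 1 + cost e"
| "cost (Add e f) = 1 + cost e + cost f"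
| "cost (Sub e f) = 1 + cost e + cost f"
| "cost (Mul e f) = 1 + cost e + cost f"

datatype com =
    Skip
  | Assign string expr
  | Store expr expr
  | Seq com com
  | Cond expr com com
  | While expr com

text \<open>
  \<open>exec W p s t s'\<close>: under word bound \<open>W\<close>, program \<open>p\<close> started in \<open>s\<close> terminates in \<open>s'\<close> after
  exactly \<open>t\<close> time units. A test succeeds if its value is nonzero.
\<close>

inductive exec :: "nat \<Rightarrow> com \<Rightarrow> ram \<Rightarrow> nat \<Rightarrow> ram \<Rightarrow> bool" for W where
  Skip: "exec W Skip s 1 s"
| Assign: "fits W s e \<Longrightarrow>
    exec W (Assign x e) s (1 + cost e) (s\<lparr>reg := (reg s)(x := val s e)\<rparr>)"
| Store: "fits W s e \<Longrightarrow> fits W s f \<Longrightarrow>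
    exec W (Store e f) s (1 + cost e + cost f) (s\<lparr>mem := (mem s)(val s e := val s f)\<rparr>)"
| Seq: "exec W p s t s' \<Longrightarrow> exec W q s' t' s'' \<Longrightarrow> exec W (Seq p q) s (t + t') s''"
| CondTrue: "fits W s e \<Longrightarrow> val s e \<noteq> 0 \<Longrightarrow> exec W p s t s' \<Longrightarrow>
    exec W (Cond e p q) s (1 + cost e + t) s'"
| CondFalse: "fits W s e \<Longrightarrow> val s e = 0 \<Longrightarrow> exec W q s t s' \<Longrightarrow>
    exec W (Cond e p q) s (1 + cost e + t) s'"
| WhileFalse: "fits W s e \<Longrightarrow> val s e = 0 \<Longrightarrow> exec W (While e p) s (1 + cost e) s"
| WhileTrue: "fits W s e \<Longrightarrow> val s e \<noteq> 0 \<Longrightarrow> exec W p s t s' \<Longrightarrow> exec W (While e p) s' t' s'' \<Longrightarrow>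
    exec W (While e p) s (1 + cost e + t + t') s''"

inductive_cases exec_SkipE: "exec W Skip s t s'"
inductive_cases exec_AssignE: "exec W (Assign x e) s t s'"
inductive_cases exec_StoreE: "exec W (Store e f) s t s'"
inductive_cases exec_SeqE: "exec W (Seq p q) s t s'"
inductive_cases exec_CondE: "exec W (Cond e p q) s t s'"
inductive_cases exec_WhileE: "exec W (While e p) s t s'"

lemma exec_deterministic:
  "exec W p s t s' \<Longrightarrow> exec W p s u s'' \<Longrightarrow> t = u \<and> s' = s''"
proof (induction arbitrary: u s'' rule: exec.induct)
  case (Skip s)
  then show ?case by (rule exec_SkipE) simp
next
  case (Assign s e x)
  from Assign.prems show ?case by (rule exec_AssignE) simp
next
  case (Store s e f)
  from Store.prems show ?case by (rule exec_StoreE) simp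
next
  case (Seq p s t s1 q t1 s2)
  from Seq.prems show ?case
  proof (rule exec_SeqE)
    fix v r w
    assume "u = v + w" and p: "exec W p s v r" and q: "exec W q r w s''"
    moreover have "t = v \<and> s1 = r" using Seq.IH(1)[OF p] .
    moreover from this q have "exec W q s1 w s''" by simp
    note Seq.IH(2)[OF this]
    ultimately show ?thesis by simp
  qed
next
  case (CondTrue s e p t s1 q)
  from CondTrue.prems show ?case
  proof (rule exec_CondE)
    fix v assume "u = Suc (cost e + v)" and p: "exec W p s v s''"
    with CondTrue.IH[OF p] show ?thesis by simp
  qed (use CondTrue.hyps(2) in simp)
next
  case (CondFalse s e q t s1 p)
  from CondFalse.prems show ?case
  proof (rule exec_CondE)
    fix v assume "u = Suc (cost e + v)" and q: "exec W q s v s''"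
    with CondFalse.IH[OF q] show ?thesis by simp
  qed (use CondFalse.hyps(2) in simp)
next
  case (WhileFalse s e p)
  from WhileFalse.prems show ?case
    by (rule exec_WhileE) (use WhileFalse.hyps(2) in simp_all)
next
  case (WhileTrue s e p t s1 t1 s2)
  from WhileTrue.prems show ?case
  proof (rule exec_WhileE)
    fix v r w
    assume "u = Suc (cost e + v + w)" and p: "exec W p s v r"
      and q: "exec W (While e p) r w s''"
    moreover have "t = v \<and> s1 = r" using WhileTrue.IH(1)[OF p] .
    moreover from this q have "exec W (While e p) s1 w s''" by simp
    note WhileTrue.IH(2)[OF this]
    ultimately show ?thesis by simp
  qed (use WhileTrue.hyps(2) in simp)
qed

section \<open>Input and output\<close>

text \<open>
  The vertices are \<open>0, \<dots>, n - 1\<close>. The memory initially holds the two adjacency matrices, row by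
  row, followed by the \<open>4 n\<close> coefficients of each constraint in turn, and is zero beyond that.
\<close>

definition adjacency_bits :: "nat \<Rightarrow> nat pair_pre_digraph \<Rightarrow> nat list" where
  "adjacency_bits n G = [of_bool ((u, v) \<in> parcs G). u \<leftarrow> [0..<n], v \<leftarrow> [0..<n]]"

definition set_bits :: "nat \<Rightarrow> nat set \<Rightarrow> nat list" where
  "set_bits n A = [of_bool (v \<in> A). v \<leftarrow> [0..<n]]"

fun quadruple_bits :: "nat \<Rightarrow> nat quadruple \<Rightarrow> nat list" where
  "quadruple_bits n (A, B, C, D) = set_bits n A @ set_bits n B @ set_bits n C @ set_bits n D"

fun constraint_bits :: "nat \<Rightarrow> nat constraint \<Rightarrow> nat list" where
  "constraint_bits n (a, b, c, d) =
     quadruple_bits n ({v. a v = 1}, {v. b v = 1}, {v. c v = 1}, {v. d v = 1})"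

definition input_bits ::
  "nat \<Rightarrow> nat pair_pre_digraph \<Rightarrow> nat pair_pre_digraph \<Rightarrow> nat constraint list \<Rightarrow> nat list" where
  "input_bits n G G' L =
     adjacency_bits n G @ adjacency_bits n G' @ concat (map (constraint_bits n) L)"

definition input_state ::
  "nat \<Rightarrow> nat pair_pre_digraph \<Rightarrow> nat pair_pre_digraph \<Rightarrow> nat constraint list \<Rightarrow> ram" where
  "input_state n G G' L =
     \<lparr>reg = (\<lambda>_. 0)(''n'' := n, ''l'' := length L),
      mem = (\<lambda>i. if i < length (input_bits n G G' L) then input_bits n G G' L ! i else 0)\<rparr>"

text \<open>
  Register \<open>''res''\<close> tells whether a quadruple was found; if so, the first \<open>4 n\<close> memory cells hold
  the indicator vectors of its components.
\<close>

fun outputs :: "nat \<Rightarrow> ram \<Rightarrow> nat quadruple option \<Rightarrow> bool" where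
  "outputs n s None \<longleftrightarrow> reg s ''res'' = 0"
| "outputs n s (Some Q) \<longleftrightarrow> reg s ''res'' = 1 \<and> map (mem s) [0..<4 * n] = quadruple_bits n Q"

end

theory Submission
  imports Defs
begin

text \<open>
  Let \<open>M\<close>, \<open>M'\<close> be the adjacency matrices, read \<open>A\<close>, \<open>B\<close>, \<open>C\<close>, \<open>D\<close> as diagonal matrices over the
  two-element field, and put \<open>P = A + B M'\<close>, \<open>Q = C + D M'\<close>. Condition (i) says \<open>M P = Q\<close>, so the
  product of the transpose of \<open>P\<close> with \<open>Q\<close> is symmetric. Comparing its entries at \<open>(x, y)\<close> and
  \<open>(y, x)\<close> for an edge \<open>xy\<close> of \<open>G'\<close> shows that the determinant \<open>A\<^sub>v D\<^sub>v + B\<^sub>v C\<^sub>v\<close> is the same at both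
  ends. As \<open>G'\<close> is connected, the determinant of a solution of (i) is constant, and (ii) only has to be
  tested at vertex \<open>0\<close>, where it is a quadratic form in the solution. A quadratic form that vanishes
  on the sums of any two vectors of a spanning list vanishes on the whole span.

  The algorithm keeps a spanning list of \<open>4 n + 1\<close> vectors for the solutions of the equations
  processed so far. Each of the \<open>n\<^sup>2 + l\<close> equations costs \<open>O(n\<^sup>2)\<close>: one violating vector is added to
  all violating vectors, itself included. Finally the sums of two vectors are tested at vertex \<open>0\<close>.
\<close>

section \<open>The determinant along edges\<close>

text \<open>For \<open>x \<noteq> y\<close> the products of two diagonal parts drop out of the entry
  at \<open>(x, y)\<close>, and the products of two \<open>M'\<close> parts are symmetric in
  \<open>x\<close> and \<open>y\<close>. Only the mixed terms remain, each with the factor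
  \<open>M' x y\<close>.\<close>

lemma det_eq_on_edge:
  fixes M M' :: "nat \<Rightarrow> nat \<Rightarrow> 'a::comm_ring_1"
  assumes char2: "\<And>x::'a. x + x = 0"
    and fin: "finite V" and x: "x \<in> V" and y: "y \<in> V"
    and sym: "\<And>u v. M u v = M v u" and sym': "\<And>u v. M' u v = M' v u"
    and eq: "\<And>u v. u \<in> V \<Longrightarrow> v \<in> V \<Longrightarrow>
      (\<Sum>w\<in>V. b w * (M u w * M' v w)) + a v * M u v + d u * M' v u + (if u = v then c u else 0) = 0"
    and edge: "M' x y = 1" and neq: "x \<noteq> y"
  shows "a x * d x + b x * c x = a y * d y + b y * c y"
proof -
  have cancel: "p = q" if "p + q = 0" for p q :: 'a
  proof -
    have "p + q = q + q" using that char2 by simp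
    then show ?thesis by (simp only: add_right_cancel)
  qed
  define P where "P w v = (if w = v then a v else 0) + b w * M' w v" for w v
  define Q where "Q u v = (if u = v then c u else 0) + d u * M' u v" for u v
  have MP: "(\<Sum>w\<in>V. M u w * P w v) = Q u v" if "u \<in> V" "v \<in> V" for u v
  proof -
    have "(\<Sum>w\<in>V. M u w * P w v) = (\<Sum>w\<in>V. (if w = v then a v * M u v else 0) + b w * (M u w * M' v w))"
      by (rule sum.cong) (auto simp: P_def algebra_simps sym')
    also have "\<dots> = a v * M u v + (\<Sum>w\<in>V. b w * (M u w * M' v w))"
      using fin that by (simp add: sum.distrib)
    also have "\<dots> = Q u v"
      by (rule cancel) (use eq[OF that] in \<open>simp add: Q_def algebra_simps sym'[of v u]\<close>)
    finally show ?thesis .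
  qed
  \<comment> \<open>\<open>F\<close> is the transpose of \<open>P\<close> times \<open>Q\<close>.
    Substituting \<open>M P\<close> for \<open>Q\<close> makes it a congruence transform of the
    symmetric \<open>M\<close>, hence symmetric.\<close>
  define F where "F v w = (\<Sum>u\<in>V. P u v * Q u w)" for v w
  have "F x y = (\<Sum>u\<in>V. \<Sum>w\<in>V. P u x * (M u w * P w y))"
    unfolding F_def by (rule sum.cong) (simp_all add: MP[symmetric] y sum_distrib_left)
  also have "\<dots> = (\<Sum>w\<in>V. \<Sum>u\<in>V. P u x * (M u w * P w y))"
    by (rule sum.swap)
  also have "\<dots> = (\<Sum>w\<in>V. P w y * (\<Sum>u\<in>V. M w u * P u x))"
    unfolding sum_distrib_left
  proof (intro sum.cong refl)
    fix u w
    show "P u x * (M u w * P w y) = P w y * (M w u * P u x)"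
      using sym[of u w] by (simp add: mult_ac)
  qed
  also have "\<dots> = F y x"
    unfolding F_def by (rule sum.cong) (simp_all add: MP x)
  finally have F: "F x y = F y x" .
  have expand: "F v w = a v * d v * M' v w + b w * c w * M' v w + (\<Sum>u\<in>V. b u * d u * (M' u v * M' u w))"
    if "v \<in> V" "w \<in> V" "v \<noteq> w" for v w
  proof -
    have "F v w = (\<Sum>u\<in>V. (if u = v then a v * d v * M' v w else 0) + (if u = w then b w * c w * M' v w else 0)
        + b u * d u * (M' u v * M' u w))"
      unfolding F_def
    proof (rule sum.cong)
      fix u assume "u \<in> V"
      show "P u v * Q u w = (if u = v then a v * d v * M' v w else 0) + (if u = w then b w * c w * M' v w else 0)
        + b u * d u * (M' u v * M' u w)"
        using that sym'[of v w] by (auto simp: P_def Q_def algebra_simps)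
    qed simp
    then show ?thesis using fin that by (simp add: sum.distrib)
  qed
  have "(\<Sum>u\<in>V. b u * d u * (M' u x * M' u y)) = (\<Sum>u\<in>V. b u * d u * (M' u y * M' u x))"
    by (simp add: mult_ac)
  \<comment> \<open>The mixed terms pair \<open>a d\<close> at one end of the edge with
    \<open>b c\<close> at the other. In characteristic 2 they can be moved across the equation and
    regrouped by vertex.\<close>
  then have "a x * d x + b y * c y = a y * d y + b x * c x"
    using F edge sym'[of x y] unfolding expand[OF x y neq] expand[OF y x neq[symmetric]]
    by simp
  then have zero: "(a x * d x + b y * c y) + (a y * d y + b x * c x) = 0"
    by (simp only: char2)
  show ?thesis
    by (rule cancel) (use zero in \<open>simp add: add_ac\<close>)
qed

text \<open>Connectedness means reachability in the symmetrised digraph, so a path may use arcs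
  backwards. This is harmless because equality of values is symmetric.\<close>

lemma connected_constant:
  assumes con: "Digraph_Component.connected (with_proj G)"
    and step: "\<And>u v. (u, v) \<in> parcs G \<Longrightarrow> f u = f v"
    and uv: "u \<in> pverts G" "v \<in> pverts G"
  shows "f u = f v"
proof -
  have "(u, v) \<in> rtrancl_on (pverts G) (\<Union>e\<in>parcs G. {(fst e, snd e), (snd e, fst e)})"
    using con uv by (auto simp: connected_def strongly_connected_def reachable_def parcs_mk_symmetric)
  then show ?thesis
    by (induction rule: rtrancl_on_induct) (auto dest: step)
qed

section \<open>Spanning lists of solution spaces\<close>

definition dot :: "nat \<Rightarrow> (nat \<Rightarrow> bit) \<Rightarrow> (nat \<Rightarrow> bit) \<Rightarrow> bit" where
  "dot m r x = (\<Sum>w<m. r w * x w)"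

lemma dot_cong: "(\<And>w. w < m \<Longrightarrow> x w = y w) \<Longrightarrow> dot m r x = dot m r y"
  unfolding dot_def by (rule sum.cong) simp_all

lemma dot_add: "dot m r (\<lambda>w. x w + c * y w) = dot m r x + c * dot m r y"
  by (simp only: dot_def distrib_left sum.distrib sum_distrib_left mult.left_commute)

lemma dot_lin: "dot m r (\<lambda>w. \<Sum>i<k. c i * B i w) = (\<Sum>i<k. c i * dot m r (B i))"
  unfolding dot_def sum_distrib_left by (subst sum.swap) (simp only: mult.left_commute)

text \<open>
  Row \<open>m\<close> is the zero vector: it is the pivot when no row violates the next constraint. Otherwise the
  pivot is the last violating row, so that updating the rows in order leaves it intact until its turn.
\<close>

definition spanning :: "nat \<Rightarrow> (nat \<Rightarrow> nat \<Rightarrow> bit) \<Rightarrow> nat \<Rightarrow> (nat \<Rightarrow> nat \<Rightarrow> bit) \<Rightarrow> bool" where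
  "spanning m C j B \<longleftrightarrow>
     (\<forall>w<m. B m w = 0) \<and> (\<forall>i\<le>m. \<forall>k<j. dot m (C k) (B i) = 0) \<and>
     (\<forall>x. (\<forall>k<j. dot m (C k) x = 0) \<longrightarrow> (\<exists>c. \<forall>w<m. x w = (\<Sum>i<m. c i * B i w)))"

definition pivot :: "nat \<Rightarrow> (nat \<Rightarrow> bit) \<Rightarrow> (nat \<Rightarrow> nat \<Rightarrow> bit) \<Rightarrow> nat \<Rightarrow> nat \<Rightarrow> bool" where
  "pivot m r B k p \<longleftrightarrow>
     (p = m \<or> p < k \<and> dot m r (B p) = 1) \<and> (\<forall>i<k. p = m \<or> p < i \<longrightarrow> dot m r (B i) = 0)"

text \<open>Over the two-element field the pivot row is added to exactly the violating rows. A
  violating pivot is added to itself and becomes zero, so the number of rows never changes.\<close>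

definition reduce :: "nat \<Rightarrow> (nat \<Rightarrow> bit) \<Rightarrow> nat \<Rightarrow> (nat \<Rightarrow> nat \<Rightarrow> bit) \<Rightarrow> nat \<Rightarrow> nat \<Rightarrow> bit" where
  "reduce m r p B i w = B i w + dot m r (B i) * B p w"

text \<open>The unit vectors span everything, and since \<open>m\<close> is not a coordinate, the
  same formula yields the zero vector as row \<open>m\<close>.\<close>

lemma spanning_identity: "spanning m C 0 (\<lambda>i w. of_bool (i = w))"
proof -
  have "x w = (\<Sum>i<m. x i * of_bool (i = w))" if "w < m" for w and x :: "nat \<Rightarrow> bit"
  proof -
    have "(\<Sum>i<m. x i * of_bool (i = w)) = (\<Sum>i<m. if i = w then x w else 0)"
      by (rule sum.cong) simp_all
    then show ?thesis using that by simp
  qed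
  then show ?thesis
    unfolding spanning_def by auto
qed

text \<open>The coefficients of a linear combination can be kept: if \<open>x\<close> satisfies the
  new equation, the coefficients of the violating rows sum to zero, and this sum is the multiple of
  the pivot row that the reduction introduces.\<close>

lemma spanning_reduce:
  assumes sp: "spanning m C j B" and piv: "pivot m (C j) B m p"
  shows "spanning m C (Suc j) (reduce m (C j) p B)"
proof -
  let ?d = "\<lambda>i. dot m (C j) (B i)"
  have zero: "B m w = 0" if "w < m" for w
    using sp that by (simp add: spanning_def)
  have dm: "dot m r (B m) = 0" for r
    unfolding dot_def by (rule sum.neutral) (simp add: zero)
  have p: "p \<le> m" using piv by (auto simp: pivot_def)
  \<comment> \<open>A violating row forces a violating pivot, whose value is 1; with the zero row as
    pivot both sides vanish.\<close>
  have dp: "?d i * ?d p = ?d i" if "i \<le> m" for i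
  proof (cases "p = m")
    case True
    then have "?d i = 0" using piv dm that by (cases "i = m") (auto simp: pivot_def)
    then show ?thesis by simp
  next
    case False
    then show ?thesis using piv by (simp add: pivot_def)
  qed
  have red: "dot m r (reduce m (C j) p B i) = dot m r (B i) + ?d i * dot m r (B p)" for r i
    using dot_add[of m r "B i" "?d i" "B p"] by (simp only: reduce_def[abs_def])
  have "dot m (C k) (reduce m (C j) p B i) = 0" if "i \<le> m" "k < Suc j" for i k
  proof (cases "k = j")
    case True
    show ?thesis unfolding True red by (simp only: dp[OF that(1)]) (cases "?d i"; simp)
  next
    case False
    then show ?thesis using sp that p by (simp add: red spanning_def)
  qed
  moreover have "\<exists>c. \<forall>w<m. x w = (\<Sum>i<m. c i * reduce m (C j) p B i w)"
    if x: "\<forall>k<Suc j. dot m (C k) x = 0" for x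
  proof -
    obtain c where c: "\<And>w. w < m \<Longrightarrow> x w = (\<Sum>i<m. c i * B i w)"
      using sp x unfolding spanning_def by (metis less_Suc_eq)
    have "dot m (C j) (\<lambda>w. \<Sum>i<m. c i * B i w) = dot m (C j) x"
      by (rule dot_cong) (simp only: c)
    then have zero_sum: "(\<Sum>i<m. c i * ?d i) = 0"
      using x by (simp only: dot_lin)
    have "(\<Sum>i<m. c i * reduce m (C j) p B i w) =
        (\<Sum>i<m. c i * B i w) + (\<Sum>i<m. c i * ?d i) * B p w" for w
      by (simp only: reduce_def distrib_left sum.distrib sum_distrib_right mult.assoc)
    then have "x w = (\<Sum>i<m. c i * reduce m (C j) p B i w)" if "w < m" for w
      using c[OF that] by (simp only: zero_sum mult_zero_left add_0_right)
    then show ?thesis by blast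
  qed
  moreover have "reduce m (C j) p B m w = 0" if "w < m" for w
    unfolding reduce_def dm zero[OF that] by simp
  ultimately show ?thesis unfolding spanning_def by blast
qed

text \<open>The coordinates \<open>0\<close>, \<open>n\<close>, \<open>2 * n\<close>,
  \<open>3 * n\<close> are the entries of \<open>A\<close>, \<open>B\<close>, \<open>C\<close>,
  \<open>D\<close> at vertex \<open>0\<close>, so this is the determinant there.\<close>

definition det0 :: "nat \<Rightarrow> (nat \<Rightarrow> bit) \<Rightarrow> bit" where
  "det0 n x = x 0 * x (3 * n) + x n * x (2 * n)"

text \<open>A quadratic form vanishing on all sums of two spanning vectors has a vanishing polar form on
  them, hence vanishes on their span.\<close>

lemma det0_eq_0_on_span:
  assumes sp: "spanning (4 * n) C j B" and n: "n > 0"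
    and pairs: "\<And>i k. i \<le> 4 * n \<Longrightarrow> k \<le> 4 * n \<Longrightarrow> det0 n (\<lambda>w. B i w + B k w) = 0"
    and x: "\<And>k. k < j \<Longrightarrow> dot (4 * n) (C k) x = 0"
  shows "det0 n x = 0"
proof -
  \<comment> \<open>\<open>q\<close> is the polar form of \<open>det0\<close>.\<close>
  define q :: "(nat \<Rightarrow> bit) \<Rightarrow> (nat \<Rightarrow> bit) \<Rightarrow> bit" where
    "q y z = y 0 * z (3 * n) + z 0 * y (3 * n) + y n * z (2 * n) + z n * y (2 * n)" for y z
  have polar: "det0 n (\<lambda>w. y w + z w) = det0 n y + det0 n z + q y z" for y z
    by (simp only: det0_def q_def algebra_simps)
  have q_lin: "q (\<lambda>w. y w + c * z w) t = q y t + c * q z t" for y z t c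
    by (simp only: q_def algebra_simps)
  \<comment> \<open>Pairing a row with the zero row \<open>4 * n\<close> gives the statement for the
    row alone.\<close>
  have single: "det0 n (B i) = 0" if "i \<le> 4 * n" for i
    using pairs[OF that order.refl] n sp by (simp add: det0_def spanning_def)
  have q0: "q (B i) (B k) = 0" if "i \<le> 4 * n" "k \<le> 4 * n" for i k
    using polar[of "B i" "B k"] pairs[OF that] by (simp only: single that) simp
  obtain c where c: "\<And>w. w < 4 * n \<Longrightarrow> x w = (\<Sum>i<4 * n. c i * B i w)"
    using sp x unfolding spanning_def by blast
  \<comment> \<open>The induction also carries the polar form of the partial sum against every row,
    since this is what adding the next row consumes.\<close>
  have "det0 n (\<lambda>w. \<Sum>i<l. c i * B i w) = 0 \<and> (\<forall>k<4 * n. q (\<lambda>w. \<Sum>i<l. c i * B i w) (B k) = 0)"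
    if "l \<le> 4 * n" for l
    using that
  proof (induction l)
    case 0
    show ?case by (simp add: det0_def q_def)
  next
    case (Suc l)
    let ?y = "\<lambda>w. \<Sum>i<l. c i * B i w"
    have y: "det0 n ?y = 0" "\<And>k. k < 4 * n \<Longrightarrow> q ?y (B k) = 0" using Suc by auto
    have l: "l < 4 * n" "l \<le> 4 * n" using Suc.prems by auto
    have sum: "(\<lambda>w. \<Sum>i<Suc l. c i * B i w) = (\<lambda>w. ?y w + c l * B l w)"
      by (simp only: sum.lessThan_Suc)
    have "det0 n (\<lambda>w. ?y w + c l * B l w) = 0"
    proof (cases "c l = 0")
      case True
      then show ?thesis using y(1) by (simp only: mult_zero_left add_0_right)
    next
      case False
      then have "c l = 1" by simp
      then show ?thesis
        using polar[of ?y "B l"] y(1) y(2)[OF l(1)] single[OF l(2)]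
        by (simp only: mult_1 add_0_right)
    qed
    moreover have "\<forall>k<4 * n. q (\<lambda>w. ?y w + c l * B l w) (B k) = 0"
      using y(2) q0 l by (simp only: q_lin) simp
    ultimately show ?case unfolding sum by blast
  qed
  from this[OF order.refl] have "det0 n (\<lambda>w. \<Sum>i<4 * n. c i * B i w) = 0" by blast
  then show ?thesis
    using n by (simp only: det0_def c)
qed

section \<open>Program logic with time bounds\<close>

text \<open>Total correctness: an execution exists, so the command terminates and every evaluated
  number stays below the word bound \<open>W\<close>.\<close>

definition runs :: "nat \<Rightarrow> com \<Rightarrow> ram \<Rightarrow> nat \<Rightarrow> (ram \<Rightarrow> bool) \<Rightarrow> bool" where
  "runs W p s T Q \<longleftrightarrow> (\<exists>t s'. exec W p s t s' \<and> t \<le> T \<and> Q s')"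

lemma runsI: "exec W p s t s' \<Longrightarrow> t \<le> T \<Longrightarrow> Q s' \<Longrightarrow> runs W p s T Q"
  unfolding runs_def by blast

lemma runs_mono: "runs W p s T Q \<Longrightarrow> T \<le> T' \<Longrightarrow> (\<And>s'. Q s' \<Longrightarrow> Q' s') \<Longrightarrow> runs W p s T' Q'"
  unfolding runs_def by (meson order_trans)

text \<open>The second command receives what is left of the budget, so that symbolic execution
  subtracts concrete costs step by step.\<close>

lemma runs_Seq:
  "runs W p s T R \<Longrightarrow> T \<le> T' \<Longrightarrow> (\<And>s'. R s' \<Longrightarrow> runs W q s' (T' - T) Q) \<Longrightarrow> runs W (Seq p q) s T' Q"
proof -
  assume "runs W p s T R" "T \<le> T'" and q: "\<And>s'. R s' \<Longrightarrow> runs W q s' (T' - T) Q"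
  then obtain t s1 where p: "exec W p s t s1" "t \<le> T" "R s1" by (auto simp: runs_def)
  from q[OF p(3)] obtain t' s2 where "exec W q s1 t' s2" "t' \<le> T' - T" "Q s2"
    by (auto simp: runs_def)
  with p \<open>T \<le> T'\<close> show "runs W (Seq p q) s T' Q"
    by (intro runsI[OF exec.Seq]) auto
qed

lemma fits_simps [simp]:
  "fits W s (Const k) \<longleftrightarrow> k < W"
  "fits W s (Reg x) \<longleftrightarrow> reg s x < W"
  "fits W s (Load e) \<longleftrightarrow> mem s (val s e) < W \<and> fits W s e"
  "fits W s (Add e f) \<longleftrightarrow> val s e + val s f < W \<and> fits W s e \<and> fits W s f"
  "fits W s (Sub e f) \<longleftrightarrow> val s e - val s f < W \<and> fits W s e \<and> fits W s f"
  "fits W s (Mul e f) \<longleftrightarrow> val s e * val s f < W \<and> fits W s e \<and> fits W s f"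
  by (auto simp: fits_def)

lemma runs_Skip [simp]: "runs W Skip s T Q \<longleftrightarrow> 1 \<le> T \<and> Q s"
  (is "?l \<longleftrightarrow> ?r")
proof
  show "?l \<Longrightarrow> ?r" by (auto simp: runs_def elim: exec_SkipE)
  show "?r \<Longrightarrow> ?l" by (rule runsI[OF exec.Skip]) auto
qed

lemma runs_Assign [simp]:
  "runs W (Assign x e) s T Q \<longleftrightarrow>
     fits W s e \<and> 1 + cost e \<le> T \<and> Q (s\<lparr>reg := (reg s)(x := val s e)\<rparr>)"
  (is "?l \<longleftrightarrow> ?r")
proof
  show "?l \<Longrightarrow> ?r" by (auto simp: runs_def elim: exec_AssignE)
  show "?r \<Longrightarrow> ?l" by (rule runsI[OF exec.Assign]) auto
qed

lemma runs_Store [simp]: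
  "runs W (Store e f) s T Q \<longleftrightarrow>
     fits W s e \<and> fits W s f \<and> 1 + cost e + cost f \<le> T \<and> Q (s\<lparr>mem := (mem s)(val s e := val s f)\<rparr>)"
  (is "?l \<longleftrightarrow> ?r")
proof
  show "?l \<Longrightarrow> ?r" by (auto simp: runs_def elim: exec_StoreE)
  show "?r \<Longrightarrow> ?l" by (rule runsI[OF exec.Store]) auto
qed

lemma runs_Seq_Assign:
  "fits W s e \<Longrightarrow> 1 + cost e \<le> T \<Longrightarrow>
     runs W q (s\<lparr>reg := (reg s)(x := val s e)\<rparr>) (T - (1 + cost e)) Q \<Longrightarrow>
   runs W (Seq (Assign x e) q) s T Q"
  by (rule runs_Seq[where T = "1 + cost e" and R = "\<lambda>s'. s' = s\<lparr>reg := (reg s)(x := val s e)\<rparr>"])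
     auto

lemma runs_Seq_Store:
  "fits W s e \<Longrightarrow> fits W s f \<Longrightarrow> 1 + cost e + cost f \<le> T \<Longrightarrow>
     runs W q (s\<lparr>mem := (mem s)(val s e := val s f)\<rparr>) (T - (1 + cost e + cost f)) Q \<Longrightarrow>
   runs W (Seq (Store e f) q) s T Q"
  by (rule runs_Seq[where T = "1 + cost e + cost f" and R = "\<lambda>s'. s' = s\<lparr>mem := (mem s)(val s e := val s f)\<rparr>"])
     auto

text \<open>As an equivalence this serves as a rewrite rule, and the simplifier can execute
  straight-line code. The direction from left to right inverts the execution relation.\<close>

lemma runs_Seq_Assign_iff:
  "runs W (Seq (Assign x e) q) s T Q \<longleftrightarrow>
     fits W s e \<and> 1 + cost e \<le> T \<and> runs W q (s\<lparr>reg := (reg s)(x := val s e)\<rparr>) (T - (1 + cost e)) Q"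
  (is "?l \<longleftrightarrow> ?r")
proof
  assume ?l
  then obtain t t' s1 s' where "exec W (Assign x e) s t s1" and q: "exec W q s1 t' s'" "t + t' \<le> T" "Q s'"
    unfolding runs_def by (auto elim!: exec_SeqE)
  then have "fits W s e" "t = 1 + cost e" "s1 = s\<lparr>reg := (reg s)(x := val s e)\<rparr>"
    by (auto elim!: exec_AssignE)
  then show ?r using q by (auto intro: runsI)
qed (auto intro: runs_Seq_Assign)

lemma runs_Seq_Store_iff:
  "runs W (Seq (Store e f) q) s T Q \<longleftrightarrow>
     fits W s e \<and> fits W s f \<and> 1 + cost e + cost f \<le> T \<and>
     runs W q (s\<lparr>mem := (mem s)(val s e := val s f)\<rparr>) (T - (1 + cost e + cost f)) Q"
  (is "?l \<longleftrightarrow> ?r")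
proof
  assume ?l
  then obtain t t' s1 s' where "exec W (Store e f) s t s1" and q: "exec W q s1 t' s'" "t + t' \<le> T" "Q s'"
    unfolding runs_def by (auto elim!: exec_SeqE)
  then have "fits W s e" "fits W s f" "t = 1 + cost e + cost f" "s1 = s\<lparr>mem := (mem s)(val s e := val s f)\<rparr>"
    by (auto elim!: exec_StoreE)
  then show ?r using q by (auto intro: runsI)
qed (auto intro: runs_Seq_Store)

lemma runs_Cond:
  assumes "fits W s e" "1 + cost e \<le> T"
    and "val s e \<noteq> 0 \<Longrightarrow> runs W p s (T - (1 + cost e)) Q"
    and "val s e = 0 \<Longrightarrow> runs W q s (T - (1 + cost e)) Q"
  shows "runs W (Cond e p q) s T Q"
proof (cases "val s e = 0")
  case True
  then obtain t s' where "exec W q s t s'" "t \<le> T - (1 + cost e)" "Q s'"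
    using assms(4) by (auto simp: runs_def)
  then show ?thesis
    using assms(2) by (intro runsI[OF exec.CondFalse[OF assms(1) True]]) auto
next
  case False
  then obtain t s' where "exec W p s t s'" "t \<le> T - (1 + cost e)" "Q s'"
    using assms(3) by (auto simp: runs_def)
  then show ?thesis
    using assms(2) by (intro runsI[OF exec.CondTrue[OF assms(1) False]]) auto
qed

text \<open>Subtraction is truncated, so the test is nonzero exactly while the counter is below the
  bound.\<close>

definition For :: "string \<Rightarrow> string \<Rightarrow> com \<Rightarrow> com" where
  "For x y p = Seq (Assign x (Const 0))
     (While (Sub (Reg y) (Reg x)) (Seq p (Assign x (Add (Reg x) (Const 1)))))"

text \<open>In each round the test and the increment cost 4 each, hence \<open>T + 8\<close>. The
  initial assignment costs 2 and the final test 4, hence the constant 6. The invariant is demanded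
  after the counter has advanced, so it may mention the counter.\<close>

lemma runs_For:
  assumes y: "reg s y = N" and N: "N < W" and xy: "x \<noteq> y"
    and init: "I 0 (s\<lparr>reg := (reg s)(x := 0)\<rparr>)"
    and step: "\<And>k s'. k < N \<Longrightarrow> I k s' \<Longrightarrow> reg s' x = k \<Longrightarrow> reg s' y = N \<Longrightarrow>
      runs W p s' T (\<lambda>s''. reg s'' x = k \<and> reg s'' y = N \<and> I (Suc k) (s''\<lparr>reg := (reg s'')(x := Suc k)\<rparr>))"
    and final: "\<And>s'. I N s' \<Longrightarrow> reg s' x = N \<Longrightarrow> reg s' y = N \<Longrightarrow> Q s'"
    and time: "N * (T + 8) + 6 \<le> T'"
  shows "runs W (For x y p) s T' Q"
proof -
  let ?while = "While (Sub (Reg y) (Reg x)) (Seq p (Assign x (Add (Reg x) (Const 1))))"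
  have loop: "runs W ?while s' ((N - k) * (T + 8) + 4) Q"
    if "k \<le> N" "I k s'" "reg s' x = k" "reg s' y = N" for k s'
    using that
  proof (induction "N - k" arbitrary: k s')
    case 0
    then have "k = N" by simp
    with 0 have "Q s'" by (intro final) simp_all
    have "exec W ?while s' (1 + cost (Sub (Reg y) (Reg x))) s'"
      by (rule exec.WhileFalse) (use \<open>k = N\<close> \<open>reg s' x = k\<close> \<open>reg s' y = N\<close> N in simp_all)
    then show ?case
      by (rule runsI) (use \<open>Q s'\<close> in simp_all)
  next
    case (Suc d)
    then have k: "k < N" by simp
    obtain t s1 where p: "exec W p s' t s1" "t \<le> T"
      and s1: "reg s1 x = k" "reg s1 y = N" "I (Suc k) (s1\<lparr>reg := (reg s1)(x := Suc k)\<rparr>)"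
      using step[OF k Suc.prems(2-4)] by (auto simp: runs_def)
    let ?s2 = "s1\<lparr>reg := (reg s1)(x := Suc k)\<rparr>"
    have "exec W (Assign x (Add (Reg x) (Const 1))) s1 4 ?s2"
      using exec.Assign[of W s1 "Add (Reg x) (Const 1)" x] s1 k N by (simp add: eval_nat_numeral)
    from exec.Seq[OF p(1) this] have body: "exec W (Seq p (Assign x (Add (Reg x) (Const 1)))) s' (t + 4) ?s2" .
    have "runs W ?while ?s2 ((N - Suc k) * (T + 8) + 4) Q"
      by (rule Suc.hyps(1)) (use Suc.hyps(2) k s1 xy in auto)
    then obtain t' s3 where w: "exec W ?while ?s2 t' s3" "t' \<le> (N - Suc k) * (T + 8) + 4" "Q s3"
      by (auto simp: runs_def)
    have "exec W ?while s' (1 + cost (Sub (Reg y) (Reg x)) + (t + 4) + t') s3"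
      by (rule exec.WhileTrue[OF _ _ body w(1)]) (use Suc.prems k N in auto)
    moreover have "N - k = Suc (N - Suc k)" using k by simp
    then have "1 + cost (Sub (Reg y) (Reg x)) + (t + 4) + t' \<le> (N - k) * (T + 8) + 4"
      using w(2) p(2) by (simp only: mult_Suc cost.simps)
    ultimately show ?case
      using w(3) by (rule runsI)
  qed
  have "runs W ?while (s\<lparr>reg := (reg s)(x := 0)\<rparr>) (T' - 2) Q"
    by (rule runs_mono[OF loop[of 0]]) (use init y xy time in auto)
  then show ?thesis
    unfolding For_def by (intro runs_Seq_Assign) (use N time in \<open>auto simp: numeral_2_eq_2\<close>)
qed

section \<open>The program\<close>

text \<open>
  Equation \<open>j\<close> has its \<open>m = 4 n\<close> coefficients at address \<open>b + m j\<close> with \<open>b = 2 n\<^sup>2\<close>, that is, the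
  equations of (i) are appended to the constraints of the input. They are followed, at address \<open>X\<close>,
  by the spanning list, one vector of length \<open>m\<close> after the other.
\<close>

definition bit_val :: "bit \<Rightarrow> nat" where
  "bit_val x = of_bool (x = 1)"

lemma bit_val_simps [simp]: "bit_val 0 = 0" "bit_val 1 = 1"
  by (simp_all add: bit_val_def)

lemma bit_val_le: "bit_val x \<le> 1"
  by (simp add: bit_val_def)

lemma bit_val_less [simp]: "1 < W \<Longrightarrow> bit_val x < W"
  using bit_val_le[of x] by linarith

lemma bit_val_eq_0_iff [simp]: "bit_val x = 0 \<longleftrightarrow> x = 0"
  by (simp add: bit_val_def)

lemma bit_val_mult [simp]: "bit_val x * bit_val y = bit_val (x * y)"
  by (simp add: bit_val_def)

lemma bit_val_add [simp]: "bit_val x - bit_val y + (bit_val y - bit_val x) = bit_val (x + y)"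
  by (cases x; cases y) simp_all

lemma bit_val_diff_less [simp]: "1 < W \<Longrightarrow> bit_val x - bit_val y < W"
  using bit_val_le[of x] by linarith

text \<open>One of the two truncated differences is always zero, so this is the absolute difference,
  which on 0 and 1 is addition over the two-element field.\<close>

abbreviation Xor :: "expr \<Rightarrow> expr \<Rightarrow> expr" where
  "Xor e f \<equiv> Add (Sub e f) (Sub f e)"

definition dot_com :: com where
  "dot_com = Seq (Assign ''d'' (Const 0))
     (For ''w'' ''m'' (Assign ''d'' (Xor (Reg ''d'')
        (Mul (Load (Add (Reg ''r'') (Reg ''w''))) (Load (Add (Reg ''q'') (Reg ''w'')))))))"

text \<open>The postcondition determines the final state completely, so callers need no separate
  frame condition.\<close>

lemma runs_dot_com:
  assumes m: "reg s ''m'' = m" and W: "1 < W" "reg s ''r'' + m < W" "reg s ''q'' + m < W"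
    and r: "\<And>w. w < m \<Longrightarrow> mem s (reg s ''r'' + w) = bit_val (x w)"
    and q: "\<And>w. w < m \<Longrightarrow> mem s (reg s ''q'' + w) = bit_val (y w)"
  shows "runs W dot_com s (32 * m + 8)
    (\<lambda>s'. s' = s\<lparr>reg := (reg s)(''d'' := bit_val (dot m x y), ''w'' := m)\<rparr>)"
  unfolding dot_com_def
proof (rule runs_Seq_Assign, goal_cases)
  case 3
  show ?case
    by (rule runs_For[where N = m and T = 24 and
          I = "\<lambda>k s'. s' = s\<lparr>reg := (reg s)(''d'' := bit_val (\<Sum>w<k. x w * y w), ''w'' := k)\<rparr>"])
       (use m W r q in \<open>simp_all add: dot_def\<close>)
qed (use W in simp_all)

definition add_row_com :: com where
  "add_row_com = For ''w'' ''m'' (Store (Add (Reg ''q'') (Reg ''w''))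
     (Xor (Load (Add (Reg ''q'') (Reg ''w''))) (Load (Add (Reg ''z'') (Reg ''w'')))))"

text \<open>Two rows coincide or are disjoint. They coincide when the pivot is added to itself; this
  is sound because each cell is read in the round in which it is overwritten.\<close>

lemma runs_add_row_com:
  fixes s :: ram
  defines "q \<equiv> reg s ''q''" and "z \<equiv> reg s ''z''"
  assumes m: "reg s ''m'' = m" and W: "1 < W" "q + m < W" "z + m < W"
    and qz: "q = z \<or> q + m \<le> z \<or> z + m \<le> q"
    and y: "\<And>w. w < m \<Longrightarrow> mem s (q + w) = bit_val (y w)"
    and x: "\<And>w. w < m \<Longrightarrow> mem s (z + w) = bit_val (x w)"
  shows "runs W add_row_com s (31 * m + 6)
    (\<lambda>s'. s' = s\<lparr>reg := (reg s)(''w'' := m),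
                 mem := \<lambda>a. if q \<le> a \<and> a < q + m then bit_val (y (a - q) + x (a - q)) else mem s a\<rparr>)"
  unfolding add_row_com_def
proof (rule runs_For[where N = m and T = 23 and
    I = "\<lambda>k s'. s' = s\<lparr>reg := (reg s)(''w'' := k),
       mem := \<lambda>a. if q \<le> a \<and> a < q + k then bit_val (y (a - q) + x (a - q)) else mem s a\<rparr>"], goal_cases)
  case (5 k s')
  \<comment> \<open>The source cell of this round is not among the cells overwritten earlier, even
    if both rows coincide.\<close>
  have z: "\<not> (q \<le> z + k \<and> z + k < q + k)"
    using qz 5(1) by linarith
  have "mem s' (z + k) = mem s (z + k)"
    using z by (cases "q \<le> z + k") (simp_all add: 5(2))
  then have "mem s' (q + k) = bit_val (y k)" "mem s' (z + k) = bit_val (x k)"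
    using 5 y x by simp_all
  then show ?case
    using 5 W by (simp add: q_def[symmetric] z_def[symmetric]) (auto simp: fun_eq_iff)
qed (use m W in \<open>auto simp: fun_eq_iff intro!: ram.equality\<close>)

section \<open>Storage of the spanning list and frame conditions\<close>

definition stores_rows :: "nat \<Rightarrow> nat \<Rightarrow> (nat \<Rightarrow> nat \<Rightarrow> bit) \<Rightarrow> ram \<Rightarrow> bool" where
  "stores_rows X m B s \<longleftrightarrow> (\<forall>i\<le>m. \<forall>w<m. mem s (X + m * i + w) = bit_val (B i w))"

lemma stores_rows_reg [simp]: "stores_rows X m B (s\<lparr>reg := f\<rparr>) = stores_rows X m B s"
  by (simp add: stores_rows_def)

text \<open>A frame condition for registers only; memory is treated separately because each phase
  protects a different region.\<close>

definition agree_except :: "string set \<Rightarrow> ram \<Rightarrow> ram \<Rightarrow> bool" where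
  "agree_except R s s' \<longleftrightarrow> (\<forall>x. x \<notin> R \<longrightarrow> reg s' x = reg s x)"

lemma agree_exceptD: "agree_except R s s' \<Longrightarrow> x \<notin> R \<Longrightarrow> reg s' x = reg s x"
  by (simp add: agree_except_def)

lemma agree_except_refl [simp]: "agree_except R s s"
  by (simp add: agree_except_def)

lemma agree_except_upd [simp]:
  "x \<in> R \<Longrightarrow> agree_except R s (s'\<lparr>reg := f(x := v)\<rparr>) = agree_except R s (s'\<lparr>reg := f\<rparr>)"
  "agree_except R s (s'\<lparr>reg := reg s'\<rparr>) = agree_except R s s'"
  "agree_except R s (s'\<lparr>mem := g\<rparr>) = agree_except R s s'"
  by (auto simp: agree_except_def)

lemma agree_except_trans: "agree_except R s s' \<Longrightarrow> agree_except R' s' s'' \<Longrightarrow> R \<union> R' \<subseteq> R'' \<Longrightarrow> agree_except R'' s s''"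
  unfolding agree_except_def by (metis UnI1 UnI2 subsetD)

lemma row_disjoint:
  fixes m :: nat
  assumes "i \<noteq> k" "w < m"
  shows "m * i + w < m * k \<or> m * k + m \<le> m * i + w"
proof (cases "i < k")
  case True
  then have "m * Suc i \<le> m * k" by (intro mult_le_mono2) simp
  then show ?thesis using assms by simp
next
  case False
  then have "m * Suc k \<le> m * i" using assms by (intro mult_le_mono2) simp
  then show ?thesis by simp
qed

section \<open>Elimination of one equation and of all equations\<close>

definition row_dot_com :: "com \<Rightarrow> com" where
  "row_dot_com p = Seq (Assign ''q'' (Add (Reg ''X'') (Mul (Reg ''m'') (Reg ''i''))))
     (Seq dot_com (Cond (Reg ''d'') p Skip))"

definition find_pivot_com :: com where
  "find_pivot_com = Seq (Assign ''p'' (Reg ''m''))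
     (For ''i'' ''m'' (row_dot_com (Assign ''p'' (Reg ''i''))))"

definition eliminate_com :: com where
  "eliminate_com = Seq (Assign ''z'' (Add (Reg ''X'') (Mul (Reg ''m'') (Reg ''p''))))
     (For ''i'' ''m'' (row_dot_com add_row_com))"

definition reduce_all_com :: com where
  "reduce_all_com = For ''j'' ''E''
     (Seq (Assign ''r'' (Add (Reg ''b'') (Mul (Reg ''m'') (Reg ''j'')))) (Seq find_pivot_com eliminate_com))"

text \<open>Pivot search and elimination differ only in the command \<open>p\<close> applied to a
  violating row. Its budget \<open>T\<close> must also cover the one unit that \<open>Skip\<close>
  takes for the other rows.\<close>

lemma runs_row_dot:
  fixes s :: ram and r y :: "nat \<Rightarrow> bit" and k m X :: nat
  defines "s' \<equiv> s\<lparr>reg := (reg s)(''q'' := X + m * k, ''d'' := bit_val (dot m r y), ''w'' := m)\<rparr>"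
  assumes m: "reg s ''m'' = m" and X: "reg s ''X'' = X" and i: "reg s ''i'' = k" and k: "k < m"
    and W: "1 < W" "X + m * m + 2 * m < W" and rX: "reg s ''r'' + m \<le> X"
    and r: "\<And>w. w < m \<Longrightarrow> mem s (reg s ''r'' + w) = bit_val (r w)"
    and y: "\<And>w. w < m \<Longrightarrow> mem s (X + m * k + w) = bit_val (y w)"
    and zero: "dot m r y = 0 \<Longrightarrow> Q s'"
    and one: "dot m r y = 1 \<Longrightarrow> runs W p s' T Q"
    and T: "1 \<le> T"
  shows "runs W (row_dot_com p) s (32 * m + 16 + T) Q"
proof -
  have mk: "m * k + m \<le> m * m"
    using mult_le_mono2[of "Suc k" m m] k by simp
  let ?s = "s\<lparr>reg := (reg s)(''q'' := X + m * k)\<rparr>"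
  have "runs W dot_com ?s (32 * m + 8) (\<lambda>s''. s'' = s')"
    by (rule runs_mono[OF runs_dot_com[where m = m and x = r and y = y]])
       (use m W rX r y mk in \<open>simp_all add: s'_def\<close>)
  moreover have "runs W (Cond (Reg ''d'') p Skip) s' (2 + T) Q"
    by (rule runs_Cond) (use W zero one T in \<open>auto simp: s'_def\<close>)
  ultimately have "runs W (Seq dot_com (Cond (Reg ''d'') p Skip)) ?s (32 * m + 10 + T) Q"
    by (elim runs_Seq) simp_all
  then have "runs W (Seq dot_com (Cond (Reg ''d'') p Skip))
      (s\<lparr>reg := (reg s)(''q'' := val s (Add (Reg ''X'') (Mul (Reg ''m'') (Reg ''i''))))\<rparr>) (32 * m + 10 + T) Q"
    by (simp add: m X i)
  then show ?thesis
    unfolding row_dot_com_def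
    by (intro runs_Seq_Assign) (use m X i k W mk in \<open>simp_all add: add_ac\<close>)
qed

text \<open>The scan runs upwards and overwrites its candidate, so the last violating row wins. By
  \<open>k < m\<close> the new index differs from \<open>m\<close>, which stands for the zero
  row.\<close>

lemma pivot_Suc:
  assumes "pivot m r B k p" "k < m"
  shows "dot m r (B k) = 0 \<Longrightarrow> pivot m r B (Suc k) p"
    and "dot m r (B k) = 1 \<Longrightarrow> pivot m r B (Suc k) k"
  using assms by (auto simp: pivot_def less_Suc_eq)

lemma runs_find_pivot:
  assumes m: "reg s ''m'' = m" and X: "reg s ''X'' = X" and W: "1 < W" "X + m * m + 2 * m < W"
    and rX: "reg s ''r'' + m \<le> X"
    and r: "\<And>w. w < m \<Longrightarrow> mem s (reg s ''r'' + w) = bit_val (r w)"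
    and B: "stores_rows X m B s"
  shows "runs W find_pivot_com s (m * (32 * m + 26) + 8)
    (\<lambda>s'. mem s' = mem s \<and> agree_except {''p'', ''i'', ''q'', ''d'', ''w''} s s' \<and> pivot m r B m (reg s' ''p''))"
  unfolding find_pivot_com_def
proof (rule runs_Seq_Assign, goal_cases)
  case 3
  let ?R = "{''p'', ''i'', ''q'', ''d'', ''w''}"
  show ?case
  proof (rule runs_For[where N = m and T = "32 * m + 18" and
      I = "\<lambda>k s'. mem s' = mem s \<and> agree_except ?R s s' \<and> pivot m r B k (reg s' ''p'')"], goal_cases)
    case (5 k s')
    have f: "agree_except ?R s s'" and mem: "mem s' = mem s" and piv: "pivot m r B k (reg s' ''p'')"
      using 5 by simp_all
    show ?case
      by (rule runs_mono[OF runs_row_dot[where m = m and X = X and k = k and r = r and y = "B k" and T = 2]])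
         (use 5 W rX r B pivot_Suc[OF piv 5(1)] f in
           \<open>auto simp: agree_exceptD[OF f] m X mem stores_rows_def\<close>)
  qed (use m W in \<open>simp_all add: pivot_def\<close>)
qed (use m W in \<open>simp_all\<close>)

text \<open>Rows are updated in place in increasing order. No row after the pivot violates the
  equation, so whenever a row is changed, the pivot row still has its original content.\<close>

lemma runs_eliminate:
  assumes m: "reg s ''m'' = m" and X: "reg s ''X'' = X" and W: "1 < W" "X + m * m + 2 * m < W"
    and rX: "reg s ''r'' + m \<le> X"
    and r: "\<And>w. w < m \<Longrightarrow> mem s (reg s ''r'' + w) = bit_val (r w)"
    and B: "stores_rows X m B s" and piv: "pivot m r B m p" and p: "reg s ''p'' = p"
    and zero: "\<And>w. w < m \<Longrightarrow> B m w = 0"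
  shows "runs W eliminate_com s (m * (63 * m + 30) + 12)
    (\<lambda>s'. agree_except {''z'', ''i'', ''q'', ''d'', ''w''} s s' \<and> (\<forall>a<X. mem s' a = mem s a) \<and>
           stores_rows X m (reduce m r p B) s')"
proof -
  have pm: "p \<le> m" using piv by (auto simp: pivot_def)
  have mp: "X + m * p + m < W" using W mult_le_mono2[OF pm, of m] by linarith
  show ?thesis
    unfolding eliminate_com_def
  proof (rule runs_Seq_Assign, goal_cases)
    case 3
    let ?R = "{''z'', ''i'', ''q'', ''d'', ''w''}"
    \<comment> \<open>\<open>?B k\<close> is the half-updated list: the rows before \<open>k\<close>
      are reduced, the others are not.\<close>
    let ?B = "\<lambda>k i. if i < k then reduce m r p B i else B i"
    have dm: "dot m r (B m) = 0"
      unfolding dot_def by (rule sum.neutral) (simp add: zero)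
    show ?case
    proof (rule runs_For[where N = m and T = "63 * m + 22" and
        I = "\<lambda>k s'. agree_except ?R s s' \<and> reg s' ''z'' = X + m * p \<and> (\<forall>a<X. mem s' a = mem s a) \<and> stores_rows X m (?B k) s'"],
        goal_cases)
      case (5 k s')
      have f: "agree_except ?R s s'" and mem: "\<And>a. a < X \<Longrightarrow> mem s' a = mem s a" and stores_rows: "stores_rows X m (?B k) s'"
        and z: "reg s' ''z'' = X + m * p"
        using 5 by simp_all
      have k: "k < m" "reg s' ''i'' = k" using 5 by simp_all
      have row: "mem s' (X + m * k + w) = bit_val (B k w)" if "w < m" for w
        using stores_rows k that by (auto simp: stores_rows_def)
      have mk: "m * k + m \<le> m * m"
        using mult_le_mono2[of "Suc k" m m] k by simp
      show ?case
      proof (rule runs_mono[OF runs_row_dot[where m = m and X = X and k = k and r = r and y = "B k" and T = "31 * m + 6"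
              and Q = "\<lambda>s''. reg s'' ''i'' = k \<and> reg s'' ''m'' = m \<and> agree_except ?R s s'' \<and>
                reg s'' ''z'' = X + m * p \<and> (\<forall>a<X. mem s'' a = mem s a) \<and> stores_rows X m (?B (Suc k)) s''"]], goal_cases)
        case 10
        have "reduce m r p B k = B k" by (simp add: fun_eq_iff reduce_def 10)
        then have "?B (Suc k) = ?B k" by (auto simp: fun_eq_iff less_Suc_eq)
        then show ?case using f mem stores_rows z k 5(4) by (simp add: stores_rows_def)
      next
        case 11
        \<comment> \<open>Row \<open>k\<close> violates the equation and the pivot is the last such
          row, so the pivot has not been updated before this round.\<close>
        have kp: "k \<le> p" using piv 11 k(1) by (auto simp: pivot_def not_le)
        have pne: "p \<noteq> m" using piv 11 k(1) by (auto simp: pivot_def)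
        have prow: "mem s' (X + m * p + w) = bit_val (B p w)" if "w < m" for w
          using stores_rows kp pm that by (auto simp: stores_rows_def)
        have red: "reduce m r p B k w = B k w + B p w" for w
          by (simp add: reduce_def 11)
        have disj: "m * k = m * p \<or> m * k + m \<le> m * p \<or> m * p + m \<le> m * k"
        proof (cases "k = p")
          case False
          then have "m * Suc k \<le> m * p" using kp by (intro mult_le_mono2) simp
          then show ?thesis by simp
        qed simp
        let ?s = "s'\<lparr>reg := (reg s')(''q'' := X + m * k, ''d'' := bit_val (dot m r (B k)), ''w'' := m)\<rparr>"
        show ?case
        proof (rule runs_mono[OF runs_add_row_com[where m = m and y = "B k" and x = "B p"]], goal_cases)
          case (9 s'')
          have mem'': "mem s'' = (\<lambda>a. if X + m * k \<le> a \<and> a < X + m * k + m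
              then bit_val (B k (a - (X + m * k)) + B p (a - (X + m * k))) else mem s' a)"
            using 9 by (simp cong: if_cong)
          have "mem s'' (X + m * i + w) = bit_val (?B (Suc k) i w)" if "i \<le> m" "w < m" for i w
          proof (cases "i = k")
            case True
            then show ?thesis using that by (simp add: mem'' red)
          next
            case False
            then have "mem s'' (X + m * i + w) = mem s' (X + m * i + w)"
              using row_disjoint[OF False that(2)] by (auto simp: mem'')
            then show ?thesis using stores_rows that False by (auto simp: stores_rows_def less_Suc_eq)
          qed
          moreover have "\<forall>a<X. mem s'' a = mem s a"
            using mem by (simp add: mem'')
          moreover have "reg s'' = (reg s')(''q'' := X + m * k, ''d'' := bit_val (dot m r (B k)), ''w'' := m)"
            using 9 by simp
          ultimately show ?case
            using f z k 5(4) by (auto simp: stores_rows_def agree_except_def)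
        qed (use W mk mp pm disj row prow z k 5(4) in \<open>auto simp: algebra_simps\<close>)
      qed (use 5 W rX r row k f in \<open>auto simp: agree_exceptD[OF f] m X mem\<close>)
    next
      case (6 s')
      \<comment> \<open>The loop does not visit row \<open>m\<close>. Its inner product is zero, so
        the reduction leaves it unchanged anyway.\<close>
      have "reduce m r p B m w = B m w" for w
        by (simp add: reduce_def dm)
      then show ?case
        using 6 by (auto simp: stores_rows_def le_less)
    qed (use m W B X p in \<open>simp_all add: stores_rows_def\<close>)
  qed (use m W X p pm mp in simp_all)
qed

text \<open>An equation takes two passes over \<open>m\<close> rows of length \<open>m\<close>, with
  about \<open>32 * m\<close> per row for the pivot search and \<open>63 * m\<close> for the
  elimination; this gives the leading term \<open>95 * m * m\<close>. The equations lie below the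
  list and stay intact.\<close>

lemma runs_reduce_all:
  assumes m: "reg s ''m'' = m" and X: "reg s ''X'' = b + m * E" and b: "reg s ''b'' = b" and E: "reg s ''E'' = E" "E < W"
    and W: "1 < W" "b + m * E + m * m + 2 * m < W"
    and C: "\<And>j w. j < E \<Longrightarrow> w < m \<Longrightarrow> mem s (b + m * j + w) = bit_val (C j w)"
    and B: "stores_rows (b + m * E) m B s" "spanning m C 0 B"
  shows "runs W reduce_all_com s (E * (95 * m * m + 56 * m + 40) + 6)
    (\<lambda>s'. agree_except {''j'', ''r'', ''p'', ''z'', ''i'', ''q'', ''d'', ''w''} s s' \<and>
          (\<exists>B'. stores_rows (b + m * E) m B' s' \<and> spanning m C E B'))"
  unfolding reduce_all_com_def
proof -
  let ?R = "{''j'', ''r'', ''p'', ''z'', ''i'', ''q'', ''d'', ''w''}"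
  let ?X = "b + m * E"
  show "runs W (For ''j'' ''E'' (Seq (Assign ''r'' (Add (Reg ''b'') (Mul (Reg ''m'') (Reg ''j''))))
      (Seq find_pivot_com eliminate_com))) s (E * (95 * m * m + 56 * m + 40) + 6)
    (\<lambda>s'. agree_except ?R s s' \<and> (\<exists>B'. stores_rows ?X m B' s' \<and> spanning m C E B'))"
  proof (rule runs_For[where N = E and T = "95 * m * m + 56 * m + 30" and
      I = "\<lambda>k s'. agree_except ?R s s' \<and> (\<forall>a<?X. mem s' a = mem s a) \<and> (\<exists>B'. stores_rows ?X m B' s' \<and> spanning m C k B')"],
      goal_cases)
    case (5 k s')
    then obtain B' where f: "agree_except ?R s s'" and mem: "\<And>a. a < ?X \<Longrightarrow> mem s' a = mem s a"
      and stores_rows: "stores_rows ?X m B' s'" and sp: "spanning m C k B'" and k: "k < E" "reg s' ''j'' = k"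
      by auto
    have mk: "m * k + m \<le> m * E"
      using mult_le_mono2[of "Suc k" E m] k by simp
    let ?s = "s'\<lparr>reg := (reg s')(''r'' := b + m * k)\<rparr>"
    have row: "mem ?s (reg ?s ''r'' + w) = bit_val (C k w)" if "w < m" for w
      using C[OF k(1) that] mem[of "b + m * k + w"] mk that by simp
    have "runs W (Seq find_pivot_com eliminate_com) ?s (95 * m * m + 56 * m + 20)
      (\<lambda>s2. reg s2 ''j'' = k \<and> reg s2 ''E'' = E \<and> agree_except ?R s s2 \<and> (\<forall>a<?X. mem s2 a = mem s a) \<and>
        (\<exists>B'. stores_rows ?X m B' s2 \<and> spanning m C (Suc k) B'))"
    proof (rule runs_Seq[OF runs_find_pivot[where m = m and X = ?X and r = "C k" and B = B']], goal_cases)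
      case (9 s1)
      let ?p = "reg s1 ''p''"
      have f1: "agree_except {''p'', ''i'', ''q'', ''d'', ''w''} ?s s1" and mem1: "mem s1 = mem s'"
        and piv: "pivot m (C k) B' m ?p"
        using 9 by simp_all
      show ?case
      proof (rule runs_mono[OF runs_eliminate[where m = m and X = ?X and r = "C k" and B = B' and p = ?p]], goal_cases)
        case (12 s2)
        have f2: "agree_except {''z'', ''i'', ''q'', ''d'', ''w''} s1 s2" using 12 by simp
        have "agree_except ?R s s2"
          using f f1 f2 unfolding agree_except_def by auto
        moreover have "reg s2 ''j'' = k" "reg s2 ''E'' = E"
          using agree_exceptD[OF f1] agree_exceptD[OF f2] k 5(4) by simp_all
        moreover have "\<forall>a<?X. mem s2 a = mem s a"
          using 12 mem mem1 by simp
        ultimately show ?case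
          using 12 spanning_reduce[OF sp piv] by blast
      qed (use agree_exceptD[OF f1] agree_exceptD[OF f] m X W mk row mem1 stores_rows piv sp in
            \<open>simp_all add: stores_rows_def spanning_def algebra_simps\<close>)
    qed (use agree_exceptD[OF f] m X W mk row stores_rows in \<open>simp_all add: stores_rows_def algebra_simps\<close>)
    then have "runs W (Seq find_pivot_com eliminate_com) (s'\<lparr>reg := (reg s')
         (''r'' := val s' (Add (Reg ''b'') (Mul (Reg ''m'') (Reg ''j''))))\<rparr>) (95 * m * m + 56 * m + 20)
      (\<lambda>s2. reg s2 ''j'' = k \<and> reg s2 ''E'' = E \<and> agree_except ?R s s2 \<and> (\<forall>a<?X. mem s2 a = mem s a) \<and>
        (\<exists>B'. stores_rows ?X m B' s2 \<and> spanning m C (Suc k) B'))"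
      by (simp add: agree_exceptD[OF f] m b k)
    then show ?case
      by (intro runs_Seq_Assign, goal_cases)
         (use agree_exceptD[OF f] m b k mk W E(2) in \<open>simp_all add: stores_rows_def runs_mono\<close>)
  qed (use E B W in \<open>simp_all add: stores_rows_def algebra_simps\<close>, blast)
qed

lemma runs_Seq_add:
  "runs W p s T R \<Longrightarrow> (\<And>s'. R s' \<Longrightarrow> runs W q s' T' Q) \<Longrightarrow> runs W (Seq p q) s (T + T') Q"
  by (erule runs_Seq) simp_all

section \<open>Generating the equations of condition (i)\<close>

text \<open>This is equation (i) for the pair \<open>(u, v)\<close>, with blocks in the order
  \<open>A\<close>, \<open>B\<close>, \<open>C\<close>, \<open>D\<close>: \<open>A\<close> enters
  only at \<open>v\<close>, \<open>C\<close> and \<open>D\<close> only at \<open>u\<close>, while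
  all of \<open>B\<close> may occur.\<close>

definition eq_coeff :: "nat \<Rightarrow> (nat \<Rightarrow> nat \<Rightarrow> bit) \<Rightarrow> (nat \<Rightarrow> nat \<Rightarrow> bit) \<Rightarrow> nat \<Rightarrow> nat \<Rightarrow> nat \<Rightarrow> bit" where
  "eq_coeff n M M' u v c =
     (if c < n then if c = v then M u v else 0
      else if c < 2 * n then M u (c - n) * M' v (c - n)
      else if c < 3 * n then if c = 2 * n + u \<and> u = v then 1 else 0
      else if c = 3 * n + u then M' v u else 0)"

text \<open>Only the \<open>n + 3\<close> coefficients that can be nonzero are written, in linear
  time; the other cells are expected to be zero already. Registers \<open>x\<close> and
  \<open>y\<close> address row \<open>u\<close> of the first adjacency matrix and row
  \<open>v\<close> of the second.\<close>

definition equation_com :: com where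
  "equation_com =
     Seq (Assign ''x'' (Mul (Reg ''u'') (Reg ''n'')))
    (Seq (Assign ''y'' (Add (Reg ''N'') (Mul (Reg ''v'') (Reg ''n''))))
    (Seq (Assign ''r'' (Add (Reg ''b'') (Mul (Reg ''m'') (Add (Reg ''l'') (Add (Reg ''x'') (Reg ''v''))))))
    (Seq (Store (Add (Reg ''r'') (Reg ''v'')) (Load (Add (Reg ''x'') (Reg ''v''))))
    (Seq (For ''w'' ''n'' (Store (Add (Reg ''r'') (Add (Reg ''n'') (Reg ''w'')))
           (Mul (Load (Add (Reg ''x'') (Reg ''w''))) (Load (Add (Reg ''y'') (Reg ''w''))))))
    (Seq (Store (Add (Reg ''r'') (Add (Mul (Const 2) (Reg ''n'')) (Reg ''u'')))
           (Sub (Const 1) (Xor (Reg ''u'') (Reg ''v''))))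
         (Store (Add (Reg ''r'') (Add (Mul (Const 3) (Reg ''n'')) (Reg ''u'')))
           (Load (Add (Reg ''y'') (Reg ''u'')))))))))"

lemma runs_equation:
  fixes n l u v W :: nat
  defines "r \<equiv> 2 * (n * n) + 4 * n * (l + (u * n + v))"
  assumes regs: "reg s ''n'' = n" "reg s ''l'' = l" "reg s ''m'' = 4 * n" "reg s ''N'' = n * n"
      "reg s ''b'' = 2 * (n * n)" "reg s ''u'' = u" "reg s ''v'' = v"
    and uv: "u < n" "v < n"
    and W: "4 < W" "2 * (n * n) + 4 * n * (l + n * n) + 4 * n < W"
    and M: "\<And>w. w < n \<Longrightarrow> mem s (u * n + w) = bit_val (M u w)"
    and M': "\<And>w. w < n \<Longrightarrow> mem s (n * n + (v * n + w)) = bit_val (M' v w)"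
    and zero: "\<And>c. c < 4 * n \<Longrightarrow> mem s (r + c) = 0"
  shows "runs W equation_com s (23 * n + 63)
    (\<lambda>s'. agree_except {''x'', ''y'', ''r'', ''w''} s s' \<and>
      (\<forall>c<4 * n. mem s' (r + c) = bit_val (eq_coeff n M M' u v c)) \<and>
      (\<forall>a. a < r \<or> r + 4 * n \<le> a \<longrightarrow> mem s' a = mem s a))"
proof -
  have un: "u * n + n \<le> n * n" "v * n + n \<le> n * n"
    using mult_le_mono1[of "Suc u" n n] mult_le_mono1[of "Suc v" n n] uv by simp_all
  have "4 * n * (l + (u * n + v)) \<le> 4 * n * (l + n * n)"
    by (rule mult_le_mono2) (use un uv in linarith)
  then have rW: "r + 4 * n < W" using W unfolding r_def by linarith
  have eW: "4 * n * (l + (u * n + v)) < W" using rW by (simp add: r_def)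
  have lW: "l + (u * n + v) < W"
    using le_less_trans[OF mult_le_mono1[of 1 "4 * n" "l + (u * n + v)"] eW] uv by simp
  have nr: "2 * (n * n) \<le> r" by (simp add: r_def)
  let ?s1 = "s\<lparr>reg := (reg s)(''x'' := u * n, ''y'' := n * n + v * n, ''r'' := r)\<rparr>"
  let ?s2 = "?s1\<lparr>mem := (mem s)(r + v := bit_val (M u v))\<rparr>"
  \<comment> \<open>\<open>?f k\<close> is the memory after writing the entry for \<open>A\<close>
    and the first \<open>k\<close> entries of the block for \<open>B\<close>.\<close>
  let ?f = "\<lambda>k a. if r + n \<le> a \<and> a < r + n + k then bit_val (M u (a - (r + n)) * M' v (a - (r + n)))
      else ((mem s)(r + v := bit_val (M u v))) a"
  let ?s3 = "?s2\<lparr>reg := (reg ?s2)(''w'' := n), mem := ?f n\<rparr>"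
  have loop: "runs W (For ''w'' ''n'' (Store (Add (Reg ''r'') (Add (Reg ''n'') (Reg ''w'')))
      (Mul (Load (Add (Reg ''x'') (Reg ''w''))) (Load (Add (Reg ''y'') (Reg ''w'')))))) ?s2 (23 * n + 6)
      (\<lambda>s'. s' = ?s3)"
  proof (rule runs_For[where N = n and T = 15 and
      I = "\<lambda>k s'. s' = ?s2\<lparr>reg := (reg ?s2)(''w'' := k), mem := ?f k\<rparr>"], goal_cases)
    case (5 k s')
    have "mem s' (u * n + k) = bit_val (M u k)" "mem s' (n * n + v * n + k) = bit_val (M' v k)"
      using 5 un nr uv M[of k] M'[of k] by (simp_all add: add.assoc)
    moreover have "reg s' = (reg ?s2)(''w'' := k)" "mem s' = ?f k" using 5 by simp_all
    ultimately show ?case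
      using 5 W rW un uv regs by (simp add: add.assoc) (auto simp: fun_eq_iff)
  qed (use regs W rW in \<open>auto simp: fun_eq_iff intro!: ram.equality\<close>)
  define g where "g = (?f n)(r + (2 * n + u) := of_bool (u = v), r + (3 * n + u) := bit_val (M' v u))"
  have dW: "1 - (u - v + (v - u)) < W" "u - v + (v - u) < W" "u - v < W" "v - u < W"
    using uv rW by auto
  \<comment> \<open>Subtracting the distance of \<open>u\<close> and \<open>v\<close> from 1,
    truncated at zero, gives the truth value of \<open>u = v\<close>.\<close>
  have eqb: "1 - (u - v + (v - u)) = (of_bool (u = v) :: nat)" by auto
  have "runs W equation_com s (23 * n + 63) (\<lambda>s'. s' = ?s3\<lparr>mem := g\<rparr>)"
  proof -
    have "runs W (Seq (Store (Add (Reg ''r'') (Add (Mul (Const 2) (Reg ''n'')) (Reg ''u'')))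
           (Sub (Const 1) (Xor (Reg ''u'') (Reg ''v''))))
         (Store (Add (Reg ''r'') (Add (Mul (Const 3) (Reg ''n'')) (Reg ''u'')))
           (Load (Add (Reg ''y'') (Reg ''u''))))) ?s3 29 (\<lambda>s'. s' = ?s3\<lparr>mem := g\<rparr>)"
      using regs uv un W rW nr M'[of u] dW by (simp add: runs_Seq_Store_iff eqb[simplified] add.assoc g_def)
    then have "runs W (Seq (For ''w'' ''n'' (Store (Add (Reg ''r'') (Add (Reg ''n'') (Reg ''w'')))
           (Mul (Load (Add (Reg ''x'') (Reg ''w''))) (Load (Add (Reg ''y'') (Reg ''w''))))))
         (Seq (Store (Add (Reg ''r'') (Add (Mul (Const 2) (Reg ''n'')) (Reg ''u'')))
           (Sub (Const 1) (Xor (Reg ''u'') (Reg ''v''))))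
         (Store (Add (Reg ''r'') (Add (Mul (Const 3) (Reg ''n'')) (Reg ''u'')))
           (Load (Add (Reg ''y'') (Reg ''u'')))))) ?s2 (35 + 23 * n) (\<lambda>s'. s' = ?s3\<lparr>mem := g\<rparr>)"
      by (intro runs_Seq[OF loop]) simp_all
    then show ?thesis
      unfolding equation_com_def using regs uv un W rW eW lW nr M[of v]
      by (simp add: runs_Seq_Assign_iff runs_Seq_Store_iff r_def[symmetric])
  qed
  then show ?thesis
  proof (rule runs_mono)
    fix s' assume s': "s' = ?s3\<lparr>mem := g\<rparr>"
    have "mem s' (r + c) = bit_val (eq_coeff n M M' u v c)" if "c < 4 * n" for c
      using zero[OF that] uv by (auto simp: s' eq_coeff_def g_def)
    moreover have "mem s' a = mem s a" if "a < r \<or> r + 4 * n \<le> a" for a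
      using that uv by (auto simp: s' g_def)
    ultimately show "agree_except {''x'', ''y'', ''r'', ''w''} s s' \<and>
      (\<forall>c<4 * n. mem s' (r + c) = bit_val (eq_coeff n M M' u v c)) \<and>
      (\<forall>a. a < r \<or> r + 4 * n \<le> a \<longrightarrow> mem s' a = mem s a)"
      by (simp add: s')
  qed simp
qed

definition equations_com :: com where
  "equations_com = For ''u'' ''n'' (For ''v'' ''n'' equation_com)"

lemma runs_equations:
  fixes n l W :: nat
  defines "base \<equiv> 2 * (n * n) + 4 * n * l"
  assumes regs: "reg s ''n'' = n" "reg s ''l'' = l" "reg s ''m'' = 4 * n" "reg s ''N'' = n * n"
      "reg s ''b'' = 2 * (n * n)"
    and W: "4 < W" "2 * (n * n) + 4 * n * (l + n * n) + 4 * n < W"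
    and M: "\<And>u w. u < n \<Longrightarrow> w < n \<Longrightarrow> mem s (u * n + w) = bit_val (M u w)"
    and M': "\<And>v w. v < n \<Longrightarrow> w < n \<Longrightarrow> mem s (n * n + (v * n + w)) = bit_val (M' v w)"
    and zero: "\<And>a. base \<le> a \<Longrightarrow> mem s a = 0"
  shows "runs W equations_com s (n * (n * (23 * n + 71) + 14) + 6)
    (\<lambda>s'. agree_except {''u'', ''v'', ''x'', ''y'', ''r'', ''w''} s s' \<and> (\<forall>a<base. mem s' a = mem s a) \<and>
      (\<forall>j<n * n. \<forall>c<4 * n. mem s' (base + 4 * n * j + c) = bit_val (eq_coeff n M M' (j div n) (j mod n) c)) \<and>
      (\<forall>a\<ge>base + 4 * n * (n * n). mem s' a = 0))"
proof -
  let ?R = "{''u'', ''v'', ''x'', ''y'', ''r'', ''w''}"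
  \<comment> \<open>After \<open>k\<close> equations, in lexicographic order of
    \<open>(u, v)\<close>, everything from the next one on must still be zero, since
    \<open>equation_com\<close> does not clear its target.\<close>
  define P where "P k s' \<longleftrightarrow> agree_except ?R s s' \<and> (\<forall>a<base. mem s' a = mem s a) \<and>
      (\<forall>j<k. \<forall>c<4 * n. mem s' (base + 4 * n * j + c) = bit_val (eq_coeff n M M' (j div n) (j mod n) c)) \<and>
      (\<forall>a\<ge>base + 4 * n * k. mem s' a = 0)" for k s'
  have P_upd: "P k (s'\<lparr>reg := (reg s')(x := i)\<rparr>) = P k s'" if "x \<in> ?R" for k s' x i
    using that by (simp add: P_def)
  have nW: "n < W" using W by linarith
  have step: "runs W equation_com s' (23 * n + 63) (\<lambda>s''. P (Suc (u * n + v)) s'' \<and>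
      reg s'' ''u'' = u \<and> reg s'' ''v'' = v)"
    if P: "P (u * n + v) s'" and uv: "reg s' ''u'' = u" "reg s' ''v'' = v" "u < n" "v < n" for u v s'
  proof -
    have f: "agree_except ?R s s'" using P by (simp add: P_def)
    let ?k = "u * n + v"
    let ?r = "2 * (n * n) + 4 * n * (l + ?k)"
    have r: "?r = base + 4 * n * ?k" by (simp add: base_def algebra_simps)
    have un: "u * n + n \<le> n * n" "v * n + n \<le> n * n"
      using mult_le_mono1[of "Suc u" n n] mult_le_mono1[of "Suc v" n n] uv by simp_all
    have low: "mem s' (u * n + w) = bit_val (M u w)" "mem s' (n * n + (v * n + w)) = bit_val (M' v w)" if "w < n" for w
    proof -
      have "u * n + w < base" "n * n + (v * n + w) < base"
        using un that by (simp_all add: base_def)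
      then show "mem s' (u * n + w) = bit_val (M u w)" "mem s' (n * n + (v * n + w)) = bit_val (M' v w)"
        using P M[OF uv(3) that] M'[OF uv(4) that] by (simp_all add: P_def)
    qed
    have z: "mem s' (?r + c) = 0" for c
      using P by (simp add: P_def r)
    show ?thesis
    proof (rule runs_mono[OF runs_equation[where n = n and l = l and u = u and v = v and M = M and M' = M']], goal_cases)
      case (16 s'')
      have f2: "agree_except {''x'', ''y'', ''r'', ''w''} s' s''"
        and new: "\<And>c. c < 4 * n \<Longrightarrow> mem s'' (?r + c) = bit_val (eq_coeff n M M' u v c)"
        and old: "\<And>a. a < ?r \<or> ?r + 4 * n \<le> a \<Longrightarrow> mem s'' a = mem s' a"
        using 16 by blast+
      have "mem s'' (base + 4 * n * j + c) = bit_val (eq_coeff n M M' (j div n) (j mod n) c)"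
        if "j < Suc ?k" "c < 4 * n" for j c
      proof (cases "j = ?k")
        case True
        have "?k div n = u" "?k mod n = v" using uv by simp_all
        then show ?thesis using new[OF that(2)] unfolding True r by simp
      next
        case False
        then have j: "j < ?k" using that by simp
        then have "4 * n * j + 4 * n \<le> 4 * n * ?k" using mult_le_mono2[of "Suc j" ?k "4 * n"] by simp
        then have "mem s'' (base + 4 * n * j + c) = mem s' (base + 4 * n * j + c)"
          using that by (intro old) (simp only: r, linarith)
        then show ?thesis using P j that by (simp add: P_def)
      qed
      moreover have "mem s'' a = 0" if "base + 4 * n * Suc ?k \<le> a" for a
      proof -
        have "base + 4 * n * ?k + 4 * n \<le> a" using that by simp
        then have "?r + 4 * n \<le> a" "base + 4 * n * ?k \<le> a" by (simp_all only: r)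
        then show ?thesis using old[of a] P by (simp add: P_def)
      qed
      moreover have "mem s'' a = mem s a" if "a < base" for a
        using old[of a] that P by (simp add: P_def r)
      moreover have "agree_except ?R s s''" by (rule agree_except_trans[OF f f2]) simp
      ultimately show ?case
        using uv agree_exceptD[OF f2] unfolding P_def by simp
    qed (use regs agree_exceptD[OF f] uv W low z in simp_all)
  qed
  have "runs W equations_com s (n * (n * (23 * n + 71) + 14) + 6) (P (n * n))"
    unfolding equations_com_def
  proof (rule runs_For[where N = n and T = "n * (23 * n + 71) + 6" and I = "\<lambda>u s'. P (u * n) s'"], goal_cases)
    case (5 u s')
    show ?case
    proof (rule runs_For[where N = n and T = "23 * n + 63" and
        I = "\<lambda>v s'. P (u * n + v) s' \<and> reg s' ''u'' = u"], goal_cases)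
      case (5 v s'')
      have f: "agree_except ?R s s''" using 5 by (simp add: P_def)
      show ?case
      proof (rule runs_mono[OF step[of u v]], goal_cases)
        case (7 s3)
        then have "agree_except ?R s s3" by (simp add: P_def)
        then show ?case using 7 regs P_upd by (simp add: agree_exceptD)
      qed (use 5 \<open>u < n\<close> in simp_all)
    next
      case (6 s'')
      then show ?case using P_upd by (simp add: add.commute)
    qed (use 5 nW P_upd in \<open>simp_all add: algebra_simps\<close>)
  next
    case 4
    show ?case using P_upd zero by (simp add: P_def)
  qed (use regs nW in simp_all)
  then show ?thesis
    by (rule runs_mono) (simp_all add: P_def)
qed

section \<open>The initial spanning list of unit vectors\<close>

definition init_com :: com where
  "init_com = For ''i'' ''m'' (Store (Add (Reg ''X'') (Add (Mul (Reg ''m'') (Reg ''i'')) (Reg ''i''))) (Const 1))"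

text \<open>The memory from \<open>X\<close> on is zero, so writing \<open>m\<close> ones on the
  diagonal suffices, and row \<open>m\<close> is the zero vector without further work.\<close>

lemma runs_init:
  assumes m: "reg s ''m'' = m" and X: "reg s ''X'' = X" and W: "1 < W" "X + m * m + 2 * m < W"
    and zero: "\<And>a. X \<le> a \<Longrightarrow> mem s a = 0"
  shows "runs W init_com s (17 * m + 6)
    (\<lambda>s'. agree_except {''i''} s s' \<and> (\<forall>a<X. mem s' a = mem s a) \<and> stores_rows X m (\<lambda>i w. of_bool (i = w)) s')"
  unfolding init_com_def
proof (rule runs_For[where N = m and T = 9 and
    I = "\<lambda>k s'. agree_except {''i''} s s' \<and> (\<forall>a. mem s' a = (if \<exists>i<k. a = X + m * i + i then 1 else mem s a))"],
    goal_cases)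
  case (5 k s')
  have mk: "m * k + m \<le> m * m"
    using mult_le_mono2[of "Suc k" m m] 5 by simp
  have f: "agree_except {''i''} s s'" using 5 by simp
  show ?case using 5 mk W
    by (auto simp: agree_exceptD[OF f] m X less_Suc_eq add.assoc)
next
  case (6 s')
  have "mem s' (X + m * i + w) = bit_val (of_bool (i = w))" if "i \<le> m" "w < m" for i w
  proof (cases "i = w")
    case True
    then show ?thesis using 6 that by auto
  next
    case False
    \<comment> \<open>The one of another row lies in another block, and the one of row
      \<open>i\<close> itself in another column.\<close>
    have "X + m * i + w \<noteq> X + m * j + j" if "j < m" for j
      using row_disjoint[of i j w m] row_disjoint[of j i j m] False \<open>w < m\<close> that by (cases "i = j") auto
    then show ?thesis using 6 False zero by auto
  qed
  moreover have "\<forall>a<X. mem s' a = mem s a" using 6 by auto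
  ultimately show ?case using 6 by (auto simp: stores_rows_def)
qed (use m W in auto)

section \<open>Search for two rows whose sum has determinant 1 at vertex \<open>0\<close>\<close>

abbreviation entry_sum :: "expr \<Rightarrow> expr" where
  "entry_sum e \<equiv> Xor (Load (Add (Reg ''q'') e)) (Load (Add (Reg ''z'') e))"

text \<open>The determinant at vertex \<open>0\<close> involves only four coordinates of the sum, so
  a pair is tested in constant time and the sum need not be formed in memory.\<close>

definition test_pair_com :: com where
  "test_pair_com =
     Seq (Assign ''z'' (Add (Reg ''X'') (Mul (Reg ''m'') (Reg ''j''))))
    (Seq (Assign ''x0'' (entry_sum (Const 0)))
    (Seq (Assign ''x1'' (entry_sum (Reg ''n'')))
    (Seq (Assign ''x2'' (entry_sum (Mul (Const 2) (Reg ''n''))))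
    (Seq (Assign ''x3'' (entry_sum (Mul (Const 3) (Reg ''n''))))
    (Seq (Assign ''d'' (Xor (Mul (Reg ''x0'') (Reg ''x3'')) (Mul (Reg ''x1'') (Reg ''x2''))))
         (Cond (Reg ''d'')
           (Seq (Assign ''res'' (Const 1)) (Seq (Assign ''e'' (Reg ''q'')) (Assign ''f'' (Reg ''z''))))
           Skip))))))"

definition search_com :: com where
  "search_com = For ''i'' ''h''
     (Seq (Assign ''q'' (Add (Reg ''X'') (Mul (Reg ''m'') (Reg ''i'')))) (For ''j'' ''h'' test_pair_com))"

text \<open>\<open>P\<close> describes the pairs tested so far. The second alternative persists once
  a pair is found; a later success merely replaces the recorded addresses by those of another
  suitable pair.\<close>

definition search_post :: "nat \<Rightarrow> nat \<Rightarrow> (nat \<Rightarrow> nat \<Rightarrow> bit) \<Rightarrow> (nat \<Rightarrow> nat \<Rightarrow> bool) \<Rightarrow> ram \<Rightarrow> bool" where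
  "search_post n X B P s \<longleftrightarrow>
     reg s ''res'' = 0 \<and> (\<forall>i j. P i j \<longrightarrow> det0 n (\<lambda>w. B i w + B j w) = 0) \<or>
     reg s ''res'' = 1 \<and> (\<exists>i\<le>4 * n. \<exists>j\<le>4 * n. reg s ''e'' = X + 4 * n * i \<and> reg s ''f'' = X + 4 * n * j \<and>
        det0 n (\<lambda>w. B i w + B j w) = 1)"

lemma search_post_upd [simp]:
  "x \<notin> {''res'', ''e'', ''f''} \<Longrightarrow>
     search_post n X B P (s\<lparr>reg := r(x := k)\<rparr>) = search_post n X B P (s\<lparr>reg := r\<rparr>)"
  "search_post n X B P (s\<lparr>reg := reg s\<rparr>) = search_post n X B P s"
  by (auto simp: search_post_def)

lemma search_post_cong:
  "(\<And>i j. P i j = P' i j) \<Longrightarrow> search_post n X B P s \<Longrightarrow> search_post n X B P' s"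
  by (simp add: search_post_def)

lemma runs_test_pair:
  assumes regs: "reg s ''n'' = n" "reg s ''m'' = 4 * n" "reg s ''X'' = X" "reg s ''q'' = X + 4 * n * i" "reg s ''j'' = j"
    and n: "n > 0" and ij: "i \<le> 4 * n" "j \<le> 4 * n"
    and W: "3 < W" "X + 4 * n * (4 * n) + 8 * n < W"
    and B: "stores_rows X (4 * n) B s" and post: "search_post n X B P s"
  shows "runs W test_pair_com s 160
    (\<lambda>s'. mem s' = mem s \<and> agree_except {''z'', ''x0'', ''x1'', ''x2'', ''x3'', ''d'', ''res'', ''e'', ''f''} s s' \<and>
      search_post n X B (\<lambda>i' j'. P i' j' \<or> i' = i \<and> j' = j) s')"
proof -
  let ?v = "\<lambda>w. B i w + B j w"
  have le: "X + 4 * n * i + 4 * n < W" "X + 4 * n * j + 4 * n < W"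
    using W mult_le_mono2[OF ij(1), of "4 * n"] mult_le_mono2[OF ij(2), of "4 * n"] by linarith+
  have Bi: "mem s (X + 4 * n * i + w) = bit_val (B i w)" if "w < 4 * n" for w
    using B ij that by (simp add: stores_rows_def)
  have Bj: "mem s (X + 4 * n * j + w) = bit_val (B j w)" if "w < 4 * n" for w
    using B ij that by (simp add: stores_rows_def)
  note mems = Bi[of 0] Bi[of n] Bi[of "2 * n"] Bi[of "3 * n"] Bj[of 0] Bj[of n] Bj[of "2 * n"] Bj[of "3 * n"]
  let ?s = "s\<lparr>reg := (reg s)(''z'' := X + 4 * n * j, ''x0'' := bit_val (?v 0), ''x1'' := bit_val (?v n),
     ''x2'' := bit_val (?v (2 * n)), ''x3'' := bit_val (?v (3 * n)), ''d'' := bit_val (det0 n ?v))\<rparr>"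
  have post': "search_post n X B P ?s"
    using post by (simp add: search_post_def)
  have "runs W (Cond (Reg ''d'')
           (Seq (Assign ''res'' (Const 1)) (Seq (Assign ''e'' (Reg ''q'')) (Assign ''f'' (Reg ''z''))))
           Skip) ?s 42
     (\<lambda>s'. mem s' = mem s \<and> agree_except {''z'', ''x0'', ''x1'', ''x2'', ''x3'', ''d'', ''res'', ''e'', ''f''} s s' \<and>
      search_post n X B (\<lambda>i' j'. P i' j' \<or> i' = i \<and> j' = j) s')"
  proof (rule runs_Cond, goal_cases)
    case 3
    then have "det0 n ?v = 1" by simp
    then show ?case
      using W le ij regs by (auto simp: runs_Seq_Assign_iff search_post_def)
  next
    case 4
    then have "det0 n ?v = 0" by simp
    then show ?case
      using post' by (auto simp: search_post_def)
  qed (use W in simp_all)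
  then show ?thesis
    unfolding test_pair_com_def
    using regs mems W le n ij
    by (simp add: runs_Seq_Assign_iff det0_def)
qed

text \<open>The bound \<open>4 * n + 1\<close> includes the zero row, so single rows are tested as
  well. There are quadratically many pairs, each at constant cost.\<close>

lemma runs_search:
  assumes regs: "reg s ''n'' = n" "reg s ''m'' = 4 * n" "reg s ''X'' = X" "reg s ''h'' = 4 * n + 1" "reg s ''res'' = 0"
    and n: "n > 0" and W: "3 < W" "X + 4 * n * (4 * n) + 8 * n < W"
    and B: "stores_rows X (4 * n) B s"
  shows "runs W search_com s ((4 * n + 1) * ((4 * n + 1) * 168 + 20) + 6)
    (\<lambda>s'. mem s' = mem s \<and> reg s' ''m'' = 4 * n \<and> search_post n X B (\<lambda>i j. i \<le> 4 * n \<and> j \<le> 4 * n) s')"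
proof -
  let ?R = "{''i'', ''j'', ''q'', ''z'', ''x0'', ''x1'', ''x2'', ''x3'', ''d'', ''res'', ''e'', ''f''}"
  have hW: "4 * n + 1 < W" using W n by linarith
  show ?thesis
    unfolding search_com_def
  proof (rule runs_For[where N = "4 * n + 1" and T = "(4 * n + 1) * 168 + 12" and
      I = "\<lambda>k s'. mem s' = mem s \<and> agree_except ?R s s' \<and> search_post n X B (\<lambda>i j. i < k \<and> j \<le> 4 * n) s'"], goal_cases)
    case (5 i s1)
    then have f: "agree_except ?R s s1" and i: "i \<le> 4 * n" "reg s1 ''i'' = i" by simp_all
    have le: "X + 4 * n * i < W"
      using W mult_le_mono2[OF i(1), of "4 * n"] by linarith
    let ?s1 = "s1\<lparr>reg := (reg s1)(''q'' := X + 4 * n * i)\<rparr>"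
    have "runs W (For ''j'' ''h'' test_pair_com) ?s1 ((4 * n + 1) * 168 + 6)
      (\<lambda>s2. mem s2 = mem s \<and> agree_except ?R s s2 \<and> search_post n X B (\<lambda>i' j. i' < Suc i \<and> j \<le> 4 * n) s2 \<and> reg s2 ''i'' = i)"
    \<comment> \<open>The pairs tested before round \<open>k\<close> are those preceding
      \<open>(i, k)\<close> lexicographically.\<close>
    proof (rule runs_For[where N = "4 * n + 1" and T = 160 and
        I = "\<lambda>k s'. mem s' = mem s \<and> agree_except ?R s s' \<and> reg s' ''q'' = X + 4 * n * i \<and> reg s' ''i'' = i \<and>
          search_post n X B (\<lambda>i' j. i' < i \<and> j \<le> 4 * n \<or> i' = i \<and> j < k) s'"], goal_cases)
      case (5 j s2)
      then have f2: "agree_except ?R s s2" and post: "search_post n X B (\<lambda>i' j'. i' < i \<and> j' \<le> 4 * n \<or> i' = i \<and> j' < j) s2"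
        by simp_all
      show ?case
      proof (rule runs_mono[OF runs_test_pair[where n = n and X = X and i = i and j = j and B = B and s = s2,
            OF _ _ _ _ _ _ _ _ _ _ _ post]], goal_cases)
        case (13 s3)
        then have f3: "agree_except {''z'', ''x0'', ''x1'', ''x2'', ''x3'', ''d'', ''res'', ''e'', ''f''} s2 s3"
          and post3: "search_post n X B (\<lambda>i' j'. (i' < i \<and> j' \<le> 4 * n \<or> i' = i \<and> j' < j) \<or> i' = i \<and> j' = j) s3"
          by simp_all
        have "search_post n X B (\<lambda>i' j'. i' < i \<and> j' \<le> 4 * n \<or> i' = i \<and> j' < Suc j) s3"
          by (rule search_post_cong[OF _ post3]) auto
        moreover have "agree_except ?R s s3" by (rule agree_except_trans[OF f2 f3]) simp
        ultimately show ?case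
          using 13 5 agree_exceptD[OF f3] by simp
      qed (use 5 agree_exceptD[OF f2] regs n i W B in \<open>simp_all add: stores_rows_def\<close>)
    next
      case (6 s2)
      have "search_post n X B (\<lambda>i' j. i' < Suc i \<and> j \<le> 4 * n) s2"
        by (rule search_post_cong[of "\<lambda>i' j. i' < i \<and> j \<le> 4 * n \<or> i' = i \<and> j < 4 * n + 1"]) (use 6 in auto)
      then show ?case using 6 by simp
    qed (use f agree_exceptD[OF f] regs hW i 5 in simp_all)
    then have "runs W (For ''j'' ''h'' test_pair_com) ?s1 ((4 * n + 1) * 168 + 6)
      (\<lambda>s2. reg s2 ''i'' = i \<and> reg s2 ''h'' = 4 * n + 1 \<and> mem s2 = mem s \<and> agree_except ?R s s2 \<and>
        search_post n X B (\<lambda>i' j. i' < Suc i \<and> j \<le> 4 * n) s2)"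
      by (rule runs_mono) (use regs in \<open>auto simp: agree_except_def\<close>)
    moreover have "val s1 (Add (Reg ''X'') (Mul (Reg ''m'') (Reg ''i''))) = X + 4 * n * i"
      using agree_exceptD[OF f] regs i by simp
    ultimately show ?case
      by (intro runs_Seq_Assign) (use agree_exceptD[OF f] regs i le W in simp_all)
  next
    case (6 s')
    have "search_post n X B (\<lambda>i j. i \<le> 4 * n \<and> j \<le> 4 * n) s'"
      by (rule search_post_cong[of "\<lambda>i j. i < 4 * n + 1 \<and> j \<le> 4 * n"]) (use 6 in auto)
    then show ?case using 6 regs agree_exceptD[of ?R s s' "''m''"] by simp
  next
    case 4
    then show ?case using regs by (simp add: search_post_def)
  qed (use regs hW in simp_all)
qed

section \<open>Output, memory layout and the complete program\<close>

definition output_com :: com where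
  "output_com = Cond (Reg ''res'')
     (For ''w'' ''m'' (Store (Reg ''w'')
        (Xor (Load (Add (Reg ''e'') (Reg ''w''))) (Load (Add (Reg ''f'') (Reg ''w''))))))
     Skip"

text \<open>Both source rows start at address \<open>m\<close> or later, while the output occupies
  the cells below \<open>m\<close>; hence writing never destroys an entry still to be read.\<close>

lemma runs_output:
  assumes m: "reg s ''m'' = m" and W: "1 < W" "m < W"
    and res: "reg s ''res'' \<le> 1"
    and ef: "reg s ''res'' = 1 \<Longrightarrow> m \<le> reg s ''e'' \<and> m \<le> reg s ''f'' \<and> reg s ''e'' + m < W \<and> reg s ''f'' + m < W \<and>
      (\<forall>w<m. mem s (reg s ''e'' + w) = bit_val (y w) \<and> mem s (reg s ''f'' + w) = bit_val (x w))"
  shows "runs W output_com s (29 * m + 8)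
    (\<lambda>s'. reg s' ''res'' = reg s ''res'' \<and> (reg s ''res'' = 1 \<longrightarrow> (\<forall>w<m. mem s' w = bit_val (y w + x w))))"
  unfolding output_com_def
proof (rule runs_Cond, goal_cases)
  case 3
  then have one: "reg s ''res'' = 1" using res by simp
  note ef = ef[OF one]
  show ?case
  proof (rule runs_For[where N = m and T = 21 and
      I = "\<lambda>k s'. agree_except {''w''} s s' \<and> (\<forall>w<k. mem s' w = bit_val (y w + x w)) \<and> (\<forall>a\<ge>m. mem s' a = mem s a)"], goal_cases)
    case (5 k s')
    then have f: "agree_except {''w''} s s'" by simp
    have "mem s' (reg s ''e'' + k) = bit_val (y k)" "mem s' (reg s ''f'' + k) = bit_val (x k)"
      using 5 ef by simp_all
    then show ?case using 5 ef W by (auto simp: agree_exceptD[OF f] m less_Suc_eq)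
  next
    case (6 s')
    then show ?case using agree_exceptD[of "{''w''}" s s' "''res''"] by simp
  qed (use m W in simp_all)
qed (use res W in auto)

definition layout_com :: com where
  "layout_com =
     Seq (Assign ''m'' (Mul (Const 4) (Reg ''n'')))
    (Seq (Assign ''N'' (Mul (Reg ''n'') (Reg ''n'')))
    (Seq (Assign ''E'' (Add (Reg ''l'') (Reg ''N'')))
    (Seq (Assign ''b'' (Mul (Const 2) (Reg ''N'')))
    (Seq (Assign ''X'' (Add (Reg ''b'') (Mul (Reg ''m'') (Reg ''E''))))
         (Assign ''h'' (Add (Reg ''m'') (Const 1)))))))"

definition main_com :: com where
  "main_com = Seq layout_com (Seq equations_com (Seq init_com (Seq reduce_all_com (Seq search_com output_com))))"

text \<open>The equations in the order of memory: the given constraints first, then those of (i),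
  with the pair \<open>(u, v)\<close> at offset \<open>u * n + v\<close>.\<close>

definition all_coeffs ::
  "nat \<Rightarrow> nat \<Rightarrow> (nat \<Rightarrow> nat \<Rightarrow> bit) \<Rightarrow> (nat \<Rightarrow> nat \<Rightarrow> bit) \<Rightarrow> (nat \<Rightarrow> nat \<Rightarrow> bit) \<Rightarrow> nat \<Rightarrow> nat \<Rightarrow> bit" where
  "all_coeffs n l K M M' j = (if j < l then K j else eq_coeff n M M' ((j - l) div n) ((j - l) mod n))"

text \<open>If the search fails, the determinant at vertex \<open>0\<close> vanishes on the whole
  solution space. If it succeeds, the sum of the two rows found is the required vector. The time
  bound is the plain sum over the six phases.\<close>

lemma runs_main:
  fixes n l W :: nat
  defines "X \<equiv> 2 * (n * n) + 4 * n * (l + n * n)"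
    and "base \<equiv> 2 * (n * n) + 4 * n * l" and "E \<equiv> l + n * n"
  assumes regs: "reg s ''n'' = n" "reg s ''l'' = l" "reg s ''res'' = 0"
    and n: "n > 0" and W: "4 < W" "X + 4 * n * (4 * n) + 8 * n < W"
    and M: "\<And>u w. u < n \<Longrightarrow> w < n \<Longrightarrow> mem s (u * n + w) = bit_val (M u w)"
    and M': "\<And>v w. v < n \<Longrightarrow> w < n \<Longrightarrow> mem s (n * n + (v * n + w)) = bit_val (M' v w)"
    and K: "\<And>j c. j < l \<Longrightarrow> c < 4 * n \<Longrightarrow> mem s (2 * (n * n) + 4 * n * j + c) = bit_val (K j c)"
    and zero: "\<And>a. base \<le> a \<Longrightarrow> mem s a = 0"
  shows "runs W main_com s
    (26 + ((n * (n * (23 * n + 71) + 14) + 6) + ((17 * (4 * n) + 6) +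
      ((E * (95 * (4 * n) * (4 * n) + 56 * (4 * n) + 40) + 6) +
       (((4 * n + 1) * ((4 * n + 1) * 168 + 20) + 6) + (29 * (4 * n) + 8))))))
    (\<lambda>s'. reg s' ''res'' = 0 \<and>
            (\<forall>x. (\<forall>j<E. dot (4 * n) (all_coeffs n l K M M' j) x = 0) \<longrightarrow> det0 n x = 0) \<or>
          reg s' ''res'' = 1 \<and>
            (\<exists>x. (\<forall>j<E. dot (4 * n) (all_coeffs n l K M M' j) x = 0) \<and> det0 n x = 1 \<and>
                 (\<forall>a<4 * n. mem s' a = bit_val (x a))))"
  (is "runs _ _ _ _ ?Q")
proof -
  let ?m = "4 * n" and ?C = "all_coeffs n l K M M'"
  have X: "X = 2 * (n * n) + ?m * E" "X = base + 4 * n * (n * n)"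
    by (simp_all add: X_def base_def E_def algebra_simps)
  have W': "n < W" "n * n < W" "E < W" "2 * (n * n) < W" "4 * n + 1 < W" "4 * n * E < W" "l < W"
  proof -
    have "E \<le> 4 * n * E" "4 * n * E \<le> X" "2 * (n * n) \<le> X" "n * n \<le> E" "l \<le> E"
      using n by (simp_all add: X) (simp_all add: E_def)
    then show "n < W" "n * n < W" "E < W" "2 * (n * n) < W" "4 * n + 1 < W" "4 * n * E < W" "l < W"
      using W n by linarith+
  qed
  let ?s1 = "s\<lparr>reg := (reg s)(''m'' := ?m, ''N'' := n * n, ''E'' := E, ''b'' := 2 * (n * n), ''X'' := X, ''h'' := ?m + 1)\<rparr>"
  have layout: "runs W layout_com s 26 (\<lambda>s1. s1 = ?s1)"
    unfolding layout_com_def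
    using regs W W' by (simp add: runs_Seq_Assign_iff X(1)[symmetric] E_def[symmetric])
  let ?R2 = "{''u'', ''v'', ''x'', ''y'', ''r'', ''w''}"
  have equations: "runs W equations_com ?s1 (n * (n * (23 * n + 71) + 14) + 6)
    (\<lambda>s2. agree_except ?R2 ?s1 s2 \<and> (\<forall>a<base. mem s2 a = mem s a) \<and>
      (\<forall>j<n * n. \<forall>c<4 * n. mem s2 (base + 4 * n * j + c) = bit_val (eq_coeff n M M' (j div n) (j mod n) c)) \<and>
      (\<forall>a\<ge>X. mem s2 a = 0))"
    by (rule runs_mono[OF runs_equations[where n = n and l = l and M = M and M' = M']])
       (use regs W M M' zero in \<open>simp_all add: X_def[symmetric] base_def[symmetric] X(2)[symmetric]\<close>)
  show ?thesis
    unfolding main_com_def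
  proof (rule runs_Seq_add[OF layout])
    fix s1 assume s1: "s1 = ?s1"
    show "runs W (Seq equations_com (Seq init_com (Seq reduce_all_com (Seq search_com output_com)))) s1
      ((n * (n * (23 * n + 71) + 14) + 6) + ((17 * (4 * n) + 6) +
      ((E * (95 * (4 * n) * (4 * n) + 56 * (4 * n) + 40) + 6) +
       (((4 * n + 1) * ((4 * n + 1) * 168 + 20) + 6) + (29 * (4 * n) + 8))))) ?Q"
      unfolding s1
    proof (rule runs_Seq_add[OF equations])
      fix s2 assume s2: "agree_except ?R2 ?s1 s2 \<and> (\<forall>a<base. mem s2 a = mem s a) \<and>
        (\<forall>j<n * n. \<forall>c<4 * n. mem s2 (base + 4 * n * j + c) = bit_val (eq_coeff n M M' (j div n) (j mod n) c)) \<and>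
        (\<forall>a\<ge>X. mem s2 a = 0)"
      have regs2: "reg s2 ''n'' = n" "reg s2 ''m'' = ?m" "reg s2 ''E'' = E" "reg s2 ''b'' = 2 * (n * n)"
          "reg s2 ''X'' = X" "reg s2 ''h'' = ?m + 1" "reg s2 ''res'' = 0"
        using s2 regs by (simp_all add: agree_except_def)
      have C2: "mem s2 (2 * (n * n) + ?m * j + c) = bit_val (?C j c)" if "j < E" "c < ?m" for j c
      proof (cases "j < l")
        case True
        have "?m * j + ?m \<le> ?m * l" using mult_le_mono2[of "Suc j" l ?m] True by simp
        then have "2 * (n * n) + ?m * j + c < base" using that by (simp add: base_def)
        then show ?thesis using s2 K[OF True that(2)] True by (simp add: all_coeffs_def)
      next
        case False
        then have "base + ?m * (j - l) = 2 * (n * n) + ?m * j"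
          by (simp add: base_def flip: distrib_left)
        moreover have "j - l < n * n" using that False by (simp add: E_def less_diff_conv2 not_less)
        ultimately show ?thesis using s2 that False by (metis all_coeffs_def)
      qed
      have init: "runs W init_com s2 (17 * ?m + 6)
        (\<lambda>s3. agree_except {''i''} s2 s3 \<and> (\<forall>a<X. mem s3 a = mem s2 a) \<and> stores_rows X ?m (\<lambda>i w. of_bool (i = w)) s3)"
        by (rule runs_init) (use regs2 W s2 in simp_all)
      show "runs W (Seq init_com (Seq reduce_all_com (Seq search_com output_com))) s2
        ((17 * (4 * n) + 6) + ((E * (95 * (4 * n) * (4 * n) + 56 * (4 * n) + 40) + 6) +
         (((4 * n + 1) * ((4 * n + 1) * 168 + 20) + 6) + (29 * (4 * n) + 8)))) ?Q"
      proof (rule runs_Seq_add[OF init])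
        fix s3 assume s3: "agree_except {''i''} s2 s3 \<and> (\<forall>a<X. mem s3 a = mem s2 a) \<and> stores_rows X ?m (\<lambda>i w. of_bool (i = w)) s3"
        have regs3: "reg s3 ''n'' = n" "reg s3 ''m'' = ?m" "reg s3 ''E'' = E" "reg s3 ''b'' = 2 * (n * n)"
            "reg s3 ''X'' = X" "reg s3 ''h'' = ?m + 1" "reg s3 ''res'' = 0"
          using s3 regs2 by (simp_all add: agree_except_def)
        have C3: "mem s3 (2 * (n * n) + ?m * j + c) = bit_val (?C j c)" if "j < E" "c < ?m" for j c
        proof -
          have "?m * j + ?m \<le> ?m * E" using mult_le_mono2[of "Suc j" E ?m] that by simp
          then have "2 * (n * n) + ?m * j + c < X" using that unfolding X(1) by linarith
          then show ?thesis using s3 C2[OF that] by simp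
        qed
        have reduce: "runs W reduce_all_com s3 (E * (95 * ?m * ?m + 56 * ?m + 40) + 6)
          (\<lambda>s4. agree_except {''j'', ''r'', ''p'', ''z'', ''i'', ''q'', ''d'', ''w''} s3 s4 \<and>
            (\<exists>B. stores_rows X ?m B s4 \<and> spanning ?m ?C E B))"
          unfolding X(1)
          by (rule runs_reduce_all[OF _ _ _ _ _ _ _ C3 s3[THEN conjunct2, THEN conjunct2, unfolded X(1)] spanning_identity])
             (use regs3 W W' in \<open>simp_all add: X(1)\<close>)
        show "runs W (Seq reduce_all_com (Seq search_com output_com)) s3
          ((E * (95 * (4 * n) * (4 * n) + 56 * (4 * n) + 40) + 6) +
           (((4 * n + 1) * ((4 * n + 1) * 168 + 20) + 6) + (29 * (4 * n) + 8))) ?Q"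
        proof (rule runs_Seq_add[OF reduce])
          fix s4 assume "agree_except {''j'', ''r'', ''p'', ''z'', ''i'', ''q'', ''d'', ''w''} s3 s4 \<and>
            (\<exists>B. stores_rows X ?m B s4 \<and> spanning ?m ?C E B)"
          then obtain B where f4: "agree_except {''j'', ''r'', ''p'', ''z'', ''i'', ''q'', ''d'', ''w''} s3 s4"
            and stores_rows: "stores_rows X ?m B s4" and sp: "spanning ?m ?C E B" by blast
          have search: "runs W search_com s4 ((?m + 1) * ((?m + 1) * 168 + 20) + 6)
            (\<lambda>s5. mem s5 = mem s4 \<and> reg s5 ''m'' = ?m \<and> search_post n X B (\<lambda>i j. i \<le> ?m \<and> j \<le> ?m) s5)"
            by (rule runs_search) (use regs3 f4 n W stores_rows in \<open>simp_all add: agree_except_def\<close>)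
          show "runs W (Seq search_com output_com) s4
            (((4 * n + 1) * ((4 * n + 1) * 168 + 20) + 6) + (29 * (4 * n) + 8)) ?Q"
          proof (rule runs_Seq_add[OF search])
            fix s5 assume s5: "mem s5 = mem s4 \<and> reg s5 ''m'' = ?m \<and>
              search_post n X B (\<lambda>i j. i \<le> ?m \<and> j \<le> ?m) s5"
            show "runs W output_com s5 (29 * (4 * n) + 8) ?Q"
            proof (cases "reg s5 ''res'' = 0")
              case True
              then have "\<And>i j. i \<le> ?m \<Longrightarrow> j \<le> ?m \<Longrightarrow> det0 n (\<lambda>w. B i w + B j w) = 0"
                using s5 by (simp add: search_post_def)
              then have "det0 n x = 0" if "\<forall>j<E. dot ?m (?C j) x = 0" for x
                using det0_eq_0_on_span[OF sp n] that by blast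
              then show ?thesis
                by (intro runs_mono[OF runs_output[where m = ?m]]) (use s5 W W' True in auto)
            next
              case False
              then obtain i j where one: "reg s5 ''res'' = 1" and ij: "i \<le> ?m" "j \<le> ?m"
                and ef: "reg s5 ''e'' = X + ?m * i" "reg s5 ''f'' = X + ?m * j"
                and det: "det0 n (\<lambda>w. B i w + B j w) = 1"
                using s5 unfolding search_post_def by auto
              have le: "X + ?m * i + ?m < W" "X + ?m * j + ?m < W"
                using W mult_le_mono2[OF ij(1), of ?m] mult_le_mono2[OF ij(2), of ?m] by linarith+
              \<comment> \<open>At least one equation of length \<open>4 * n\<close> precedes the
                spanning list, so the output cells lie below it.\<close>
              have "1 \<le> E" using n by (cases n) (simp_all add: E_def)
              then have "?m \<le> ?m * E" using mult_le_mono2[of 1 E ?m] by simp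
              then have "?m \<le> X" unfolding X(1) by (rule trans_le_add2)
              moreover have "mem s5 (X + ?m * i + w) = bit_val (B i w)" "mem s5 (X + ?m * j + w) = bit_val (B j w)"
                if "w < ?m" for w
                using s5 stores_rows ij that by (simp_all add: stores_rows_def)
              moreover define y where "y w = B i w + B j w" for w
              ultimately have out: "runs W output_com s5 (29 * ?m + 8) (\<lambda>s'. reg s' ''res'' = reg s5 ''res'' \<and>
                (reg s5 ''res'' = 1 \<longrightarrow> (\<forall>w<?m. mem s' w = bit_val (y w))))"
                unfolding y_def by (intro runs_output) (use s5 W W' one ef le in auto)
              \<comment> \<open>By linearity, the sum of two rows again satisfies every
                equation.\<close>
              have "dot ?m (?C k) y = 0" if "k < E" for k
                using sp ij that dot_add[of ?m "?C k" "B i" 1 "B j"] by (simp add: spanning_def y_def[abs_def])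
              moreover have "det0 n y = 1"
                using det by (simp only: y_def[abs_def])
              ultimately show ?thesis
                using one by (intro runs_mono[OF out]) auto
            qed
          qed
        qed
      qed
    qed
  qed
qed

section \<open>Input, output and correctness\<close>

fun vec :: "nat \<Rightarrow> nat quadruple \<Rightarrow> nat \<Rightarrow> bit" where
  "vec n (A, B, C, D) c = of_bool
     (if c < n then c \<in> A else if c < 2 * n then c - n \<in> B
      else if c < 3 * n then c - 2 * n \<in> C else c - 3 * n \<in> D)"

fun coeff_vec :: "nat \<Rightarrow> nat constraint \<Rightarrow> nat \<Rightarrow> bit" where
  "coeff_vec n (a, b, c, d) = vec n ({v. a v = 1}, {v. b v = 1}, {v. c v = 1}, {v. d v = 1})"

definition adj :: "nat pair_pre_digraph \<Rightarrow> nat \<Rightarrow> nat \<Rightarrow> bit" where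
  "adj G u v = of_bool ((u, v) \<in> parcs G)"

lemma vec_blocks:
  assumes "v < n"
  shows "vec n (A, B, C, D) v = of_bool (v \<in> A)"
    and "vec n (A, B, C, D) (n + v) = of_bool (v \<in> B)"
    and "vec n (A, B, C, D) (2 * n + v) = of_bool (v \<in> C)"
    and "vec n (A, B, C, D) (3 * n + v) = of_bool (v \<in> D)"
  using assms by simp_all

lemma bit_val_of_bool [simp]: "bit_val (of_bool b) = of_bool b"
  by (simp add: bit_val_def)

lemma quadruple_bits_eq: "quadruple_bits n Q = map (\<lambda>c. bit_val (vec n Q c)) [0..<4 * n]"
proof -
  obtain A B C D where Q: "Q = (A, B, C, D)" by (cases Q) auto
  show ?thesis
    unfolding Q
  proof (rule nth_equalityI)
    fix i assume "i < length (quadruple_bits n (A, B, C, D))"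
    then have "i < 4 * n" by (simp add: set_bits_def)
    then consider "i < n" | v where "v < n" "i = n + v" | v where "v < n" "i = 2 * n + v"
      | v where "v < n" "i = 3 * n + v"
      using that(1) that(2)[of "i - n"] that(3)[of "i - 2 * n"] that(4)[of "i - 3 * n"] by linarith
    then show "quadruple_bits n (A, B, C, D) ! i = map (\<lambda>c. bit_val (vec n (A, B, C, D) c)) [0..<4 * n] ! i"
      by cases (simp_all del: vec.simps add: vec_blocks set_bits_def nth_append)
  qed (simp add: set_bits_def)
qed

lemma constraint_bits_eq: "constraint_bits n l = map (\<lambda>c. bit_val (coeff_vec n l c)) [0..<4 * n]"
  by (cases l) (simp only: constraint_bits.simps coeff_vec.simps quadruple_bits_eq)

lemma length_concat_uniform:
  assumes "\<And>xs. xs \<in> set xss \<Longrightarrow> length xs = k"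
  shows "length (concat xss) = length xss * k"
  using assms by (induction xss) auto

lemma nth_concat_uniform:
  assumes "\<And>xs. xs \<in> set xss \<Longrightarrow> length xs = k" and "i < length xss" and "j < k"
  shows "concat xss ! (i * k + j) = xss ! i ! j"
  using assms
proof (induction xss arbitrary: i)
  case (Cons xs xss)
  then show ?case by (cases i) (auto simp: nth_append)
qed simp

lemma adjacency_bits:
  shows length_adjacency_bits: "length (adjacency_bits n G) = n * n"
    and nth_adjacency_bits: "u < n \<Longrightarrow> v < n \<Longrightarrow> adjacency_bits n G ! (u * n + v) = bit_val (adj G u v)"
  unfolding adjacency_bits_def
  by (subst length_concat_uniform[where k = n] nth_concat_uniform[where k = n]; auto simp: adj_def)+

lemma input_state_regs:
  "reg (input_state n G G' L) ''n'' = n" "reg (input_state n G G' L) ''l'' = length L"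
  "reg (input_state n G G' L) ''res'' = 0"
  by (simp_all add: input_state_def)

lemma input_state_mem:
  shows "u < n \<Longrightarrow> v < n \<Longrightarrow> mem (input_state n G G' L) (u * n + v) = bit_val (adj G u v)" (is "_ \<Longrightarrow> _ \<Longrightarrow> ?G")
    and "u < n \<Longrightarrow> v < n \<Longrightarrow> mem (input_state n G G' L) (n * n + (u * n + v)) = bit_val (adj G' u v)"
      (is "_ \<Longrightarrow> _ \<Longrightarrow> ?G'")
    and "j < length L \<Longrightarrow> c < 4 * n \<Longrightarrow>
      mem (input_state n G G' L) (2 * (n * n) + 4 * n * j + c) = bit_val (coeff_vec n (L ! j) c)" (is "_ \<Longrightarrow> _ \<Longrightarrow> ?L")
    and "2 * (n * n) + 4 * n * length L \<le> a \<Longrightarrow> mem (input_state n G G' L) a = 0"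
proof -
  let ?K = "map (constraint_bits n) L"
  have K: "length xs = 4 * n" if "xs \<in> set ?K" for xs
    using that by (auto simp: constraint_bits_eq)
  have len: "length (input_bits n G G' L) = 2 * (n * n) + 4 * n * length L"
    using length_concat_uniform[where xss = ?K, OF K]
    by (simp del: length_concat add: input_bits_def length_adjacency_bits mult.commute)
  show "2 * (n * n) + 4 * n * length L \<le> a \<Longrightarrow> mem (input_state n G G' L) a = 0"
    by (simp add: input_state_def len)
  {
    assume uv: "u < n" "v < n"
    have "u * n + n \<le> n * n" using mult_le_mono1[of "Suc u" n n] uv by simp
    then have "u * n + v < n * n" using uv by simp
    then show ?G ?G'
      using uv by (simp_all add: input_state_def len) 
        (simp_all add: input_bits_def nth_append length_adjacency_bits nth_adjacency_bits)
  }
  {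
    assume jc: "j < length L" "c < 4 * n"
    have "4 * n * j + 4 * n \<le> 4 * n * length L"
      using mult_le_mono2[of "Suc j" "length L" "4 * n"] jc by simp
    then have "2 * (n * n) + 4 * n * j + c < 2 * (n * n) + 4 * n * length L" using jc by simp
    moreover have "concat ?K ! (4 * n * j + c) = bit_val (coeff_vec n (L ! j) c)"
      using nth_concat_uniform[where xss = ?K and i = j and j = c, OF K] jc by (simp add: constraint_bits_eq mult.commute)
    \<comment> \<open>In this form the address skips the two adjacency matrices one after the
      other.\<close>
    moreover have "2 * (n * n) + 4 * n * j + c = n * n + (n * n + (4 * n * j + c))" by simp
    ultimately show ?L
      unfolding input_state_def ram.simps len
      by (simp add: input_bits_def nth_append length_adjacency_bits)
  }
qed

section \<open>The conditions on quadruples as inner products and determinants\<close>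

lemma sum_lessThan_add:
  fixes f :: "nat \<Rightarrow> 'a::comm_monoid_add"
  shows "(\<Sum>w<a + b. f w) = (\<Sum>w<a. f w) + (\<Sum>w<b. f (a + w))"
  by (induction b) (simp_all add: add.assoc)

lemma dot_blocks:
  "dot (4 * n) r x = (\<Sum>v<n. r v * x v) + (\<Sum>v<n. r (n + v) * x (n + v)) +
     (\<Sum>v<n. r (2 * n + v) * x (2 * n + v)) + (\<Sum>v<n. r (3 * n + v) * x (3 * n + v))"
proof -
  have n4: "4 * n = n + (n + (n + n))" and n2: "2 * n = n + n" and n3: "3 * n = n + (n + n)" by simp_all
  show ?thesis
    unfolding dot_def n4 n2 n3 by (simp only: sum_lessThan_add add.assoc)
qed

lemma satisfies_iff_dot: "satisfies {..<n} Q l \<longleftrightarrow> dot (4 * n) (coeff_vec n l) (vec n Q) = 0"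
proof -
  obtain A B C D where Q: "Q = (A, B, C, D)" by (cases Q) auto
  obtain a b c d where l: "l = (a, b, c, d)" by (cases l) auto
  have bool: "of_bool (x = 1) = x" for x :: bit by (cases x) simp_all
  have ind: "indicator S v = (of_bool (v \<in> S) :: bit)" for S and v :: nat
    by (simp add: indicator_def)
  have "dot (4 * n) (coeff_vec n l) (vec n Q) =
      (\<Sum>v<n. a v * indicator A v) + (\<Sum>v<n. b v * indicator B v) +
      (\<Sum>v<n. c v * indicator C v) + (\<Sum>v<n. d v * indicator D v)"
    unfolding dot_blocks Q l coeff_vec.simps
    by (intro arg_cong2[where f = "(+)"] sum.cong refl) (simp_all only: vec_blocks lessThan_iff mem_Collect_eq bool ind)
  then show ?thesis
    by (simp only: Q l satisfies.simps sum.distrib)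
qed

text \<open>This puts an equation of (i) into the shape that \<open>det_eq_on_edge\<close> expects,
  with the four blocks of \<open>x\<close> as \<open>a\<close>, \<open>b\<close>, \<open>c\<close>,
  \<open>d\<close>.\<close>

lemma dot_eq_coeff:
  assumes uv: "u < n" "v < n"
  shows "dot (4 * n) (eq_coeff n M M' u v) x =
    (\<Sum>w<n. x (n + w) * (M u w * M' v w)) + x v * M u v + x (3 * n + u) * M' v u +
    (if u = v then x (2 * n + u) else 0)"
proof -
  have "(\<Sum>w<n. eq_coeff n M M' u v w * x w) = (\<Sum>w<n. if w = v then x v * M u v else 0)"
    by (rule sum.cong) (simp_all add: eq_coeff_def mult.commute)
  also have "\<dots> = x v * M u v" using uv by simp
  finally have 1: "(\<Sum>w<n. eq_coeff n M M' u v w * x w) = x v * M u v" .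
  have 2: "(\<Sum>w<n. eq_coeff n M M' u v (n + w) * x (n + w)) = (\<Sum>w<n. x (n + w) * (M u w * M' v w))"
    by (rule sum.cong) (simp_all add: eq_coeff_def mult.commute)
  have "(\<Sum>w<n. eq_coeff n M M' u v (2 * n + w) * x (2 * n + w)) =
      (\<Sum>w<n. if w = u then if u = v then x (2 * n + u) else 0 else 0)"
    by (rule sum.cong) (simp_all add: eq_coeff_def)
  also have "\<dots> = (if u = v then x (2 * n + u) else 0)" using uv by simp
  finally have 3: "(\<Sum>w<n. eq_coeff n M M' u v (2 * n + w) * x (2 * n + w)) = (if u = v then x (2 * n + u) else 0)" .
  have "(\<Sum>w<n. eq_coeff n M M' u v (3 * n + w) * x (3 * n + w)) = (\<Sum>w<n. if w = u then x (3 * n + u) * M' v u else 0)"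
    by (rule sum.cong) (simp_all add: eq_coeff_def mult.commute)
  also have "\<dots> = x (3 * n + u) * M' v u" using uv by simp
  finally have 4: "(\<Sum>w<n. eq_coeff n M M' u v (3 * n + w) * x (3 * n + w)) = x (3 * n + u) * M' v u" .
  show ?thesis
    unfolding dot_blocks 1 2 3 4 by (simp only: add_ac)
qed

lemma of_nat_bit_eq_0_iff: "of_nat k = (0::bit) \<longleftrightarrow> k mod 2 = 0"
  by (induction k) (auto simp: mod_Suc)

text \<open>Each cardinality, read modulo 2, is a product of indicators or a sum of such products.
  That \<open>B\<close> lies in the vertex set makes the sum over all vertices count its whole
  intersection.\<close>

lemma cond_i_iff_dot:
  assumes Q: "subsets_of {..<n} Q"
  shows "cond_i {..<n} G G' Q \<longleftrightarrow>
    (\<forall>u<n. \<forall>v<n. dot (4 * n) (eq_coeff n (adj G) (adj G') u v) (vec n Q) = 0)"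
proof -
  obtain A B C D where q: "Q = (A, B, C, D)" by (cases Q) auto
  have "dot (4 * n) (eq_coeff n (adj G) (adj G') u v) (vec n Q) =
      of_nat (card (B \<inter> nbhd G u \<inter> nbhd G' v) + card (A \<inter> nbhd G u \<inter> {v})
         + card (D \<inter> {u} \<inter> nbhd G' v) + card (C \<inter> {u} \<inter> {v}))" if uv: "u < n" "v < n" for u v
  proof -
    have "(\<Sum>w<n. vec n Q (n + w) * (adj G u w * adj G' v w)) = (\<Sum>w<n. of_bool (w \<in> B \<inter> nbhd G u \<inter> nbhd G' v))"
      by (rule sum.cong) (simp_all add: q adj_def nbhd_def flip: of_bool_conj del: vec.simps add: vec_blocks)
    also have "\<dots> = of_nat (card ({..<n} \<inter> {w. w \<in> B \<inter> nbhd G u \<inter> nbhd G' v}))"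
      by simp
    also have "{..<n} \<inter> {w. w \<in> B \<inter> nbhd G u \<inter> nbhd G' v} = B \<inter> nbhd G u \<inter> nbhd G' v"
      using Q by (auto simp: q)
    finally have 1: "(\<Sum>w<n. vec n Q (n + w) * (adj G u w * adj G' v w)) = of_nat (card (B \<inter> nbhd G u \<inter> nbhd G' v))" .
    have "A \<inter> nbhd G u \<inter> {v} = (if v \<in> A \<and> (u, v) \<in> parcs G then {v} else {})"
      by (auto simp: nbhd_def)
    then have 2: "vec n Q v * adj G u v = of_nat (card (A \<inter> nbhd G u \<inter> {v}))"
      using uv by (simp add: q adj_def)
    have "D \<inter> {u} \<inter> nbhd G' v = (if u \<in> D \<and> (v, u) \<in> parcs G' then {u} else {})"
      by (auto simp: nbhd_def)
    then have 3: "vec n Q (3 * n + u) * adj G' v u = of_nat (card (D \<inter> {u} \<inter> nbhd G' v))"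
      using uv by (simp add: q adj_def)
    have "C \<inter> {u} \<inter> {v} = (if u = v \<and> u \<in> C then {u} else {})" by auto
    then have 4: "(if u = v then vec n Q (2 * n + u) else 0) = of_nat (card (C \<inter> {u} \<inter> {v}))"
      using uv by (simp add: q)
    show ?thesis
      unfolding dot_eq_coeff[OF uv] 1 2 3 4 by (simp only: of_nat_add)
  qed
  then have iff: "dot (4 * n) (eq_coeff n (adj G) (adj G') u v) (vec n Q) = 0 \<longleftrightarrow>
      (card (B \<inter> nbhd G u \<inter> nbhd G' v) + card (A \<inter> nbhd G u \<inter> {v})
         + card (D \<inter> {u} \<inter> nbhd G' v) + card (C \<inter> {u} \<inter> {v})) mod 2 = 0" if "u < n" "v < n" for u v
    using that by (simp only: of_nat_bit_eq_0_iff)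
  show ?thesis
    unfolding q cond_i.simps
  proof (intro iffI ballI allI impI, goal_cases)
    case (1 u v)
    show ?case
      by (rule iff[OF 1(2,3), unfolded q, THEN iffD2], rule 1(1)[THEN bspec, THEN bspec]) (simp_all only: 1 lessThan_iff)
  next
    case (2 u v)
    then have uv: "u < n" "v < n" by (simp_all only: lessThan_iff)
    show ?case
      by (rule iff[OF uv, unfolded q, THEN iffD1], rule 2(1)[rule_format, OF uv])
  qed
qed

text \<open>The inverse of \<open>vec n\<close> on the first \<open>4 * n\<close>
  coordinates.\<close>

definition quad_of :: "nat \<Rightarrow> (nat \<Rightarrow> bit) \<Rightarrow> nat quadruple" where
  "quad_of n x = ({v. v < n \<and> x v = 1}, {v. v < n \<and> x (n + v) = 1},
     {v. v < n \<and> x (2 * n + v) = 1}, {v. v < n \<and> x (3 * n + v) = 1})"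

lemma subsets_of_quad_of: "subsets_of {..<n} (quad_of n x)"
  by (auto simp: quad_of_def)

lemma vec_quad_of: "c < 4 * n \<Longrightarrow> vec n (quad_of n x) c = x c"
proof -
  have bool: "of_bool (y = 1) = y" for y :: bit by (cases y) simp_all
  assume "c < 4 * n"
  then consider "c < n" | v where "v < n" "c = n + v" | v where "v < n" "c = 2 * n + v"
    | v where "v < n" "c = 3 * n + v"
    using that(1) that(2)[of "c - n"] that(3)[of "c - 2 * n"] that(4)[of "c - 3 * n"] by linarith
  then show ?thesis
    unfolding quad_of_def by cases (simp_all only: vec_blocks mem_Collect_eq bool simp_thms)
qed

text \<open>Membership of \<open>v\<close> in the symmetric difference is the exclusive or of two
  conjunctions, which over the two-element field is the determinant at \<open>v\<close>.\<close>

lemma cond_ii_iff_det: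
  assumes Q: "subsets_of {..<n} Q"
  shows "cond_ii {..<n} Q \<longleftrightarrow>
    (\<forall>v<n. vec n Q v * vec n Q (3 * n + v) + vec n Q (n + v) * vec n Q (2 * n + v) = 1)"
proof -
  obtain A B C D where q: "Q = (A, B, C, D)" by (cases Q) auto
  have "vec n Q v * vec n Q (3 * n + v) + vec n Q (n + v) * vec n Q (2 * n + v) = 1 \<longleftrightarrow>
      v \<in> sym_diff (A \<inter> D) (B \<inter> C)" if "v < n" for v
    unfolding q vec_blocks[OF that]
    by (cases "v \<in> A"; cases "v \<in> B"; cases "v \<in> C"; cases "v \<in> D") simp_all
  moreover have "sym_diff (A \<inter> D) (B \<inter> C) \<subseteq> {..<n}" using Q by (auto simp: q)
  ultimately show ?thesis unfolding q cond_ii.simps by blast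
qed

text \<open>The determinant agrees at the ends of every arc of \<open>G'\<close> by
  \<open>det_eq_on_edge\<close>, and connectedness of \<open>G'\<close> spreads this to all
  vertices.\<close>

lemma det_constant:
  assumes G: "pair_graph G" "pverts G = {..<n}"
    and G': "pair_graph G'" "pverts G' = {..<n}" "Digraph_Component.connected (with_proj G')"
    and eq: "\<And>u v. u < n \<Longrightarrow> v < n \<Longrightarrow> dot (4 * n) (eq_coeff n (adj G) (adj G') u v) x = 0"
    and uv: "u < n" "v < n"
  shows "x u * x (3 * n + u) + x (n + u) * x (2 * n + u) = x v * x (3 * n + v) + x (n + v) * x (2 * n + v)"
proof -
  interpret G: pair_graph G by (rule G)
  interpret G': pair_graph G' by (rule G')
  let ?det = "\<lambda>v. x v * x (3 * n + v) + x (n + v) * x (2 * n + v)"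
  have sym: "adj G u v = adj G v u" for u v
    using G.pair_sym_arcs by (auto simp: adj_def symmetric_def dest: symD)
  have sym': "adj G' u v = adj G' v u" for u v
    using G'.pair_sym_arcs by (auto simp: adj_def symmetric_def dest: symD)
  have edge: "?det u = ?det v" if e: "(u, v) \<in> parcs G'" for u v
  proof -
    have uv: "u < n" "v < n" using G'.in_arcsD1[OF e] G'.in_arcsD2[OF e] G' by auto
    have neq: "u \<noteq> v" using G'.pair_no_loops[OF e] by simp
    show ?thesis
    proof (rule det_eq_on_edge[where V = "{..<n}" and M = "adj G" and M' = "adj G'"
          and a = x and b = "\<lambda>v. x (n + v)" and c = "\<lambda>v. x (2 * n + v)" and d = "\<lambda>v. x (3 * n + v)"])
      fix u v assume "u \<in> {..<n}" "v \<in> {..<n}"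
      then show "(\<Sum>w\<in>{..<n}. x (n + w) * (adj G u w * adj G' v w)) + x v * adj G u v +
          x (3 * n + u) * adj G' v u + (if u = v then x (2 * n + u) else 0) = 0"
        using eq[of u v] unfolding dot_eq_coeff[of u n v] by (simp only: lessThan_iff dot_eq_coeff)
    next
      show "y + y = 0" for y :: bit by (cases y) simp_all
    qed (use uv neq e sym sym' in \<open>simp_all add: adj_def\<close>)
  qed
  show ?thesis
    using connected_constant[OF G'(3), of ?det u v] edge uv G'(2) by auto
qed

text \<open>This reduces the quadratic condition (ii) at all vertices to one equation at vertex
  \<open>0\<close>, next to a linear system.\<close>

lemma is_solution_iff_det0:
  assumes G: "pair_graph G" "pverts G = {..<n}"
    and G': "pair_graph G'" "pverts G' = {..<n}" "Digraph_Component.connected (with_proj G')"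
    and n: "n > 0"
  shows "is_solution {..<n} G G' L Q \<longleftrightarrow> subsets_of {..<n} Q \<and>
    (\<forall>j<length L + n * n.
      dot (4 * n) (all_coeffs n (length L) (\<lambda>j. coeff_vec n (L ! j)) (adj G) (adj G') j) (vec n Q) = 0) \<and>
    det0 n (vec n Q) = 1"
proof (cases "subsets_of {..<n} Q")
  case Q: True
  let ?C = "all_coeffs n (length L) (\<lambda>j. coeff_vec n (L ! j)) (adj G) (adj G')"
  let ?E = "eq_coeff n (adj G) (adj G')"
  have L: "(\<forall>l\<in>set L. satisfies {..<n} Q l) \<longleftrightarrow> (\<forall>j<length L. dot (4 * n) (?C j) (vec n Q) = 0)"
    unfolding all_set_conv_all_nth satisfies_iff_dot all_coeffs_def by simp
  have E: "cond_i {..<n} G G' Q \<longleftrightarrow> (\<forall>j<n * n. dot (4 * n) (?C (length L + j)) (vec n Q) = 0)"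
  proof -
    have "(\<forall>u<n. \<forall>v<n. dot (4 * n) (?E u v) (vec n Q) = 0) \<longleftrightarrow>
        (\<forall>j<n * n. dot (4 * n) (?E (j div n) (j mod n)) (vec n Q) = 0)" (is "?l \<longleftrightarrow> ?r")
    proof
      show "?l \<Longrightarrow> ?r" using n by (simp add: less_mult_imp_div_less)
      assume r: ?r
      show ?l
      proof (intro allI impI)
        fix u v assume uv: "u < n" "v < n"
        have "u * n + n \<le> n * n" using mult_le_mono1[of "Suc u" n n] uv by simp
        then have "u * n + v < n * n" using uv by simp
        then show "dot (4 * n) (?E u v) (vec n Q) = 0" using r[rule_format, of "u * n + v"] uv by simp
      qed
    qed
    then show ?thesis
      unfolding cond_i_iff_dot[OF Q] by (simp add: all_coeffs_def)
  qed
  have split: "(\<forall>j<length L + n * n. P j) \<longleftrightarrow> (\<forall>j<length L. P j) \<and> (\<forall>j<n * n. P (length L + j))" for P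
  proof (intro iffI conjI allI impI)
    fix j assume P: "(\<forall>j<length L. P j) \<and> (\<forall>j<n * n. P (length L + j))" and j: "j < length L + n * n"
    show "P j"
    proof (cases "j < length L")
      case False
      then show ?thesis using P[THEN conjunct2, rule_format, of "j - length L"] j by simp
    qed (use P in simp)
  qed simp_all
  \<comment> \<open>The equivalence is claimed only under (i), which makes the determinant
    constant.\<close>
  have "cond_ii {..<n} Q \<longleftrightarrow> det0 n (vec n Q) = 1" if "cond_i {..<n} G G' Q"
  proof -
    have "\<And>u v. u < n \<Longrightarrow> v < n \<Longrightarrow> dot (4 * n) (?E u v) (vec n Q) = 0"
      using that unfolding cond_i_iff_dot[OF Q] by blast
    from det_constant[OF G G' this, of _ 0] n
    show ?thesis unfolding cond_ii_iff_det[OF Q] det0_def by auto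
  qed
  then show ?thesis
    unfolding is_solution_def L E split using Q by blast
qed (simp add: is_solution_def)

section \<open>Word size and running time\<close>

text \<open>With \<open>S = n + l + 1\<close> the addresses are at most \<open>17 * S ^ 3\<close>.
  As \<open>S \<ge> 2\<close>, five further factors \<open>S\<close> contribute at least 32 and
  absorb the constant, whence the exponent 8.\<close>

lemma word_bound:
  fixes n l :: nat
  assumes n: "n > 0"
  shows "4 < (n + l + 1) ^ 8"
    and "2 * (n * n) + 4 * n * (l + n * n) + 4 * n * (4 * n) + 8 * n < (n + l + 1) ^ 8"
proof -
  define S where "S = n + l + 1"
  have S: "2 \<le> S" "n \<le> S" "l \<le> S" using n by (simp_all add: S_def)
  have "2 ^ 5 * S ^ 3 \<le> S ^ 5 * S ^ 3"
    by (intro mult_le_mono1 power_mono S) simp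
  also have "\<dots> = S ^ 8" by (simp flip: power_add)
  finally have 8: "32 * S ^ 3 \<le> S ^ 8" by simp
  have "2 * 2 * S \<le> S * S * S" by (intro mult_le_mono1 mult_le_mono S)
  then have 1: "4 * S \<le> S ^ 3" by (simp add: power3_eq_cube)
  have "2 * (S * S) \<le> S * (S * S)" by (intro mult_le_mono1 S)
  then have 2: "2 * (S * S) \<le> S ^ 3" by (simp add: power3_eq_cube)
  have nn: "n * n \<le> S * S" "n * l \<le> S * S" by (intro mult_le_mono S)+
  have "n * (n * n) \<le> S * (S * S)" by (intro mult_le_mono S)
  then have nnn: "n * (n * n) \<le> S ^ 3" by (simp add: power3_eq_cube)
  have e: "2 * (n * n) + 4 * n * (l + n * n) + 4 * n * (4 * n) + 8 * n =
      18 * (n * n) + 4 * (n * l) + 4 * (n * (n * n)) + 8 * n"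
    by (simp add: algebra_simps)
  have "4 < S ^ 8" "18 * (n * n) + 4 * (n * l) + 4 * (n * (n * n)) + 8 * n < S ^ 8"
    using 8 1 2 nn nnn S by linarith+
  then show "4 < (n + l + 1) ^ 8"
    and "2 * (n * n) + 4 * n * (l + n * n) + 4 * n * (4 * n) + 8 * n < (n + l + 1) ^ 8"
    unfolding e S_def by simp_all
qed

text \<open>For \<open>n > 0\<close> every monomial is at most \<open>P\<close>, the product of
  \<open>l + n * n\<close> and \<open>n * n\<close>; the coefficients add up to 6434.\<close>

lemma time_bound:
  fixes n l :: nat
  assumes n: "n > 0"
  shows "26 + ((n * (n * (23 * n + 71) + 14) + 6) + ((17 * (4 * n) + 6) +
      (((l + n * n) * (95 * (4 * n) * (4 * n) + 56 * (4 * n) + 40) + 6) +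
       (((4 * n + 1) * ((4 * n + 1) * 168 + 20) + 6) + (29 * (4 * n) + 8)))))
    \<le> 7000 * ((n\<^sup>2 + l) * n\<^sup>2)"
proof -
  define E where "E = l + n * n"
  define P where "P = E * (n * n)"
  have nn: "n \<le> n * n" using n by simp
  have E: "n * n \<le> E" "1 \<le> E" "E * 1 \<le> P" "E * n \<le> P"
  proof -
    show "n * n \<le> E" by (simp add: E_def)
    show "1 \<le> E" using n by (cases n) (simp_all add: E_def)
    show "E * 1 \<le> P" "E * n \<le> P" unfolding P_def using n by (intro mult_le_mono2; simp)+
  qed
  have "n * (n * n) \<le> E * (n * n)" using E(1) nn by (intro mult_le_mono1) linarith
  then have n3: "n * (n * n) \<le> P" by (simp add: P_def)
  have "26 + ((n * (n * (23 * n + 71) + 14) + 6) + ((17 * (4 * n) + 6) +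
      ((E * (95 * (4 * n) * (4 * n) + 56 * (4 * n) + 40) + 6) +
       (((4 * n + 1) * ((4 * n + 1) * 168 + 20) + 6) + (29 * (4 * n) + 8))))) =
    246 + 1622 * n + 2759 * (n * n) + 23 * (n * (n * n)) + 1520 * P + 224 * (E * n) + 40 * E"
    by (simp add: P_def algebra_simps)
  also have "\<dots> \<le> 7000 * P"
    using E n3 nn by linarith
  finally show ?thesis
    by (simp add: P_def E_def power2_eq_square add.commute)
qed

section \<open>Existence, correctness and running time of the algorithm\<close>

theorem proposition10:
  shows "\<exists>(p :: com) (c :: nat) (k :: nat).
    \<forall>(n :: nat) (G :: nat pair_pre_digraph) (G' :: nat pair_pre_digraph) (L :: nat constraint list).
      pair_graph G \<and> pverts G = {..<n} \<and> Digraph_Component.connected (with_proj G) \<and>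
      (\<exists>v\<in>{..<n}. even (card (nbhd G v))) \<and>
      pair_graph G' \<and> pverts G' = {..<n} \<and> Digraph_Component.connected (with_proj G') \<and>
      (\<exists>v\<in>{..<n}. even (card (nbhd G' v)))
      \<longrightarrow>
      (\<exists>t s. exec ((n + length L + 1) ^ k) p (input_state n G G' L) t s \<and>
             t \<le> c * ((n\<^sup>2 + length L) * n\<^sup>2) \<and>
             (if \<exists>Q. is_solution {..<n} G G' L Q
              then \<exists>Q. is_solution {..<n} G G' L Q \<and> outputs n s (Some Q)
              else outputs n s None))"
proof (rule exI[of _ main_com], rule exI[of _ 7000], rule exI[of _ 8], intro allI impI)
  fix n :: nat and G G' :: "nat pair_pre_digraph" and L :: "nat constraint list"
  assume hyp: "pair_graph G \<and> pverts G = {..<n} \<and> Digraph_Component.connected (with_proj G) \<and>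
      (\<exists>v\<in>{..<n}. even (card (nbhd G v))) \<and>
      pair_graph G' \<and> pverts G' = {..<n} \<and> Digraph_Component.connected (with_proj G') \<and>
      (\<exists>v\<in>{..<n}. even (card (nbhd G' v)))"
  have G: "pair_graph G" "pverts G = {..<n}"
    and G': "pair_graph G'" "pverts G' = {..<n}" "Digraph_Component.connected (with_proj G')"
    using hyp by blast+
  \<comment> \<open>A vertex of even degree shows that the vertex set is nonempty, so vertex
    \<open>0\<close> exists.\<close>
  from hyp obtain v where "v \<in> {..<n}" by blast
  then have n: "n > 0" by (cases n) simp_all
  let ?s = "input_state n G G' L" and ?E = "length L + n * n"
  let ?C = "all_coeffs n (length L) (\<lambda>j. coeff_vec n (L ! j)) (adj G) (adj G')"
  note sol = is_solution_iff_det0[OF G G' n, of L]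
  let ?W = "(n + length L + 1) ^ 8"
  have "runs ?W main_com ?s (7000 * ((n\<^sup>2 + length L) * n\<^sup>2))
    (\<lambda>s'. reg s' ''res'' = 0 \<and> (\<forall>x. (\<forall>j<?E. dot (4 * n) (?C j) x = 0) \<longrightarrow> det0 n x = 0) \<or>
          reg s' ''res'' = 1 \<and>
            (\<exists>x. (\<forall>j<?E. dot (4 * n) (?C j) x = 0) \<and> det0 n x = 1 \<and> (\<forall>a<4 * n. mem s' a = bit_val (x a))))"
    (is "runs _ _ _ _ ?Q")
  proof (rule runs_mono)
    show "runs ?W main_com ?s
      (26 + ((n * (n * (23 * n + 71) + 14) + 6) + ((17 * (4 * n) + 6) +
      (((length L + n * n) * (95 * (4 * n) * (4 * n) + 56 * (4 * n) + 40) + 6) +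
       (((4 * n + 1) * ((4 * n + 1) * 168 + 20) + 6) + (29 * (4 * n) + 8)))))) ?Q"
    proof (rule runs_main)
      fix u v assume uv: "u < n" "v < n"
      show "mem ?s (u * n + v) = bit_val (adj G u v)" "mem ?s (n * n + (u * n + v)) = bit_val (adj G' u v)"
        by (rule input_state_mem(1)[OF uv], rule input_state_mem(2)[OF uv])
    next
      fix j c assume jc: "j < length L" "c < 4 * n"
      show "mem ?s (2 * (n * n) + 4 * n * j + c) = bit_val (coeff_vec n (L ! j) c)"
        by (rule input_state_mem(3)[OF jc])
    next
      fix a assume a: "2 * (n * n) + 4 * n * length L \<le> a"
      show "mem ?s a = 0" by (rule input_state_mem(4)[OF a])
    qed (rule input_state_regs n word_bound[OF n])+
  qed (rule time_bound[OF n])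
  then obtain t s where run: "exec ?W main_com ?s t s" "t \<le> 7000 * ((n\<^sup>2 + length L) * n\<^sup>2)"
    and res: "reg s ''res'' = 0 \<and> (\<forall>x. (\<forall>j<?E. dot (4 * n) (?C j) x = 0) \<longrightarrow> det0 n x = 0) \<or>
       reg s ''res'' = 1 \<and>
         (\<exists>x. (\<forall>j<?E. dot (4 * n) (?C j) x = 0) \<and> det0 n x = 1 \<and> (\<forall>a<4 * n. mem s a = bit_val (x a)))"
    unfolding runs_def by blast
  from res have "if \<exists>Q. is_solution {..<n} G G' L Q
      then \<exists>Q. is_solution {..<n} G G' L Q \<and> outputs n s (Some Q) else outputs n s None"
  proof
    assume none: "reg s ''res'' = 0 \<and> (\<forall>x. (\<forall>j<?E. dot (4 * n) (?C j) x = 0) \<longrightarrow> det0 n x = 0)"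
    then have "\<not> is_solution {..<n} G G' L Q" for Q
      unfolding sol by (metis zero_neq_one)
    then show ?thesis using none by simp
  next
    assume "reg s ''res'' = 1 \<and>
      (\<exists>x. (\<forall>j<?E. dot (4 * n) (?C j) x = 0) \<and> det0 n x = 1 \<and> (\<forall>a<4 * n. mem s a = bit_val (x a)))"
    then obtain x where one: "reg s ''res'' = 1" and x: "\<And>j. j < ?E \<Longrightarrow> dot (4 * n) (?C j) x = 0"
      "det0 n x = 1" and mem: "\<And>a. a < 4 * n \<Longrightarrow> mem s a = bit_val (x a)" by blast
    \<comment> \<open>The vector found and the vector of its quadruple agree on the first
      \<open>4 * n\<close> coordinates, which are all that \<open>dot\<close> inspects.\<close>
    have "dot (4 * n) r (vec n (quad_of n x)) = dot (4 * n) r x" for r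
      by (rule dot_cong) (rule vec_quad_of)
    moreover have "det0 n (vec n (quad_of n x)) = det0 n x"
      unfolding det0_def using n by (simp only: vec_quad_of)
    ultimately have "is_solution {..<n} G G' L (quad_of n x)"
      unfolding sol using x subsets_of_quad_of by simp
    moreover have "outputs n s (Some (quad_of n x))"
      unfolding outputs.simps quadruple_bits_eq using one mem vec_quad_of by simp
    ultimately show ?thesis by (subst if_P) blast+
  qed
  with run show "\<exists>t s. exec ?W main_com ?s t s \<and> t \<le> 7000 * ((n\<^sup>2 + length L) * n\<^sup>2) \<and>
      (if \<exists>Q. is_solution {..<n} G G' L Q
       then \<exists>Q. is_solution {..<n} G G' L Q \<and> outputs n s (Some Q)
       else outputs n s None)" by blast
qed

end
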